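(* Let $0<\alpha<1$, $\beta>0$, $y(x)=x^\beta$, and let $t>0$ be fixed. For integers $n\ge2$ let $h=t/n$ and $y_k=y(kh)$. Then, as $n\to\infty$ (with $nh=t$), $$\frac{1}{\Gamma(2-\alpha)h^\alpha}\left(\sum_{k=1}^{n-1}\left((k+1)^{1-\alpha}-2k^{1-\alpha}+(k-1)^{1-\alpha} \right)y_{n-k}+y_n\right)=y_n^{(\alpha)}+\frac{\zeta(-\beta)}{\Gamma(-\alpha)t^{1+\alpha}}h^{1+\beta}+O\left(h^{2-\alpha}\right).$$
   Context: $\zeta$ is the Riemann zeta function (analytically continued). $y_n=y(t)$ and $y_n^{(\alpha)}=y^{(\alpha)}(t)$ is the Caputo derivative $y^{(\alpha)}(t)=\frac{1}{\Gamma(1-\alpha)}\int_0^t \frac{y'(x)}{(t-x)^\alpha}\,dx$, which for $y(x)=x^\beta$ equals $\frac{\Gamma(1+\beta)}{\Gamma(1+\beta-\alpha)}t^{\beta-\alpha}$. *)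

theory Defs
  imports
    "HOL-Complex_Analysis.Complex_Analysis"
    "HOL-Library.Landau_Symbols"
begin

subsection \<open>The Riemann zeta function\<close>

text \<open>
  The analytic continuation of the Dirichlet series to the punctured plane. Since functions are
  total, a value at the pole has to be fixed for uniqueness; it is \<open>0\<close> by convention.
  Existence and uniqueness are established in \<open>ex1_zeta_continuation\<close> below.
\<close>

definition is_zeta_continuation :: "(complex \<Rightarrow> complex) \<Rightarrow> bool" where
  "is_zeta_continuation f \<longleftrightarrow>
     f holomorphic_on (- {1}) \<and> f 1 = 0 \<and>
     (\<forall>s. Re s > 1 \<longrightarrow> (\<lambda>n. 1 / of_nat (Suc n) powr s) sums f s)"

definition zeta :: "complex \<Rightarrow> complex" where
  "zeta = (THE f. is_zeta_continuation f)"

lemma holomorphic_suminf_local_M_test: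
  fixes f :: "nat \<Rightarrow> complex \<Rightarrow> complex"
  assumes "open S" and hol: "\<And>n. f n holomorphic_on S"
    and bnd: "\<And>x. x \<in> S \<Longrightarrow> \<exists>d>0. cball x d \<subseteq> S \<and>
            (\<exists>M. summable M \<and> (\<forall>n. \<forall>z\<in>cball x d. norm (f n z) \<le> M n))"
  shows "(\<lambda>z. \<Sum>n. f n z) holomorphic_on S"
proof (rule holomorphic_uniform_sequence[OF \<open>open S\<close>])
  show "(\<lambda>z. \<Sum>i<n. f i z) holomorphic_on S" for n
    by (intro holomorphic_intros hol)
  fix x assume "x \<in> S"
  from bnd[OF this] obtain d M where "d > 0" "cball x d \<subseteq> S" "summable M"
    "\<And>n z. z \<in> cball x d \<Longrightarrow> norm (f n z) \<le> M n" by blast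
  then show "\<exists>d. 0 < d \<and> cball x d \<subseteq> S \<and>
      uniform_limit (cball x d) (\<lambda>n z. \<Sum>i<n. f i z) (\<lambda>z. \<Sum>n. f n z) sequentially"
    using Weierstrass_m_test[of "cball x d" f M] by blast
qed

lemma halfplane_cball:
  assumes "Re x > c"
  obtains d \<sigma> where "d > 0" "\<sigma> > c" "\<And>z. z \<in> cball x d \<Longrightarrow> Re z \<ge> \<sigma>"
proof
  show "(Re x - c) / 2 > 0" "(Re x + c) / 2 > c" using assms by auto
  show "Re z \<ge> (Re x + c) / 2" if "z \<in> cball x ((Re x - c) / 2)" for z
  proof -
    have "Re (x - z) \<le> norm (x - z)" by (rule complex_Re_le_cmod)
    also have "\<dots> \<le> (Re x - c) / 2" using that by (simp add: dist_norm)
    finally show ?thesis by (simp add: field_simps)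
  qed
qed

lemma norm_nat_powr: "norm (of_nat (Suc n) powr (s::complex)) = real (Suc n) powr Re s"
  using norm_powr_real_powr[of "of_nat (Suc n)" s] by (simp del: of_nat_Suc)

lemma summable_Suc_powr: "c < -1 \<Longrightarrow> summable (\<lambda>n. real (Suc n) powr c)"
  using summable_real_powr_iff[of c] by (subst summable_Suc_iff) simp

definition dirichlet_zeta :: "complex \<Rightarrow> complex" where
  "dirichlet_zeta s = (\<Sum>n. of_nat (Suc n) powr (- s))"

lemma dirichlet_zeta_sums:
  assumes "Re s > 1"
  shows "(\<lambda>n. of_nat (Suc n) powr (- s)) sums dirichlet_zeta s"
proof -
  have "summable (\<lambda>n. norm (of_nat (Suc n) powr (- s)))"
    unfolding norm_nat_powr using assms by (intro summable_Suc_powr) simp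
  then show ?thesis
    unfolding dirichlet_zeta_def by (rule summable_sums[OF summable_norm_cancel])
qed

lemma dirichlet_zeta_holomorphic: "dirichlet_zeta holomorphic_on {s. Re s > 1}"
  unfolding dirichlet_zeta_def
proof (rule holomorphic_suminf_local_M_test)
  show "open {s. Re s > 1}" by (rule open_halfspace_Re_gt)
  show "(\<lambda>s. of_nat (Suc n) powr (- s)) holomorphic_on {s. Re s > 1}" for n
    by (intro holomorphic_intros) (auto simp del: of_nat_Suc)
  fix x assume "x \<in> {s. Re s > 1}"
  then obtain d \<sigma> where d: "d > 0" "\<sigma> > 1" "\<And>z. z \<in> cball x d \<Longrightarrow> Re z \<ge> \<sigma>"
    using halfplane_cball[of 1 x] by auto
  moreover have "norm (of_nat (Suc n) powr (- z)) \<le> real (Suc n) powr (- \<sigma>)"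
    if "z \<in> cball x d" for n z
    unfolding norm_nat_powr using d(3)[OF that] by (intro powr_mono) auto
  moreover have "summable (\<lambda>n. real (Suc n) powr (- \<sigma>))"
    using d by (intro summable_Suc_powr) auto
  moreover have "cball x d \<subseteq> {s. Re s > 1}" using d(2,3) by fastforce
  ultimately show "\<exists>d>0. cball x d \<subseteq> {s. Re s > 1} \<and>
      (\<exists>M. summable M \<and> (\<forall>n. \<forall>z\<in>cball x d. norm (of_nat (Suc n) powr (- z)) \<le> M n))"
    by blast
qed

text \<open>The Taylor remainder of \<open>x \<mapsto> x powr (1 - s)\<close> between consecutive integers.\<close>

definition zeta_rem :: "nat \<Rightarrow> nat \<Rightarrow> complex \<Rightarrow> complex" where
  "zeta_rem K n s = (\<Sum>k\<le>K. ((1 - s) gchoose k) * of_nat (Suc n) powr (1 - s - of_nat k))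
                     - of_nat (Suc (Suc n)) powr (1 - s)"

lemma zeta_rem_bound:
  assumes "Re s > - real K"
  shows "norm (zeta_rem K n s) \<le>
     norm (\<Prod>j<Suc K. 1 - s - of_nat j) * real (Suc n) powr (- Re s - real K)"
proof -
  define a where "a = 1 - s"
  define f where "f = (\<lambda>i (x::complex). (\<Prod>j<i. a - of_nat j) * x powr (a - of_nat i))"
  define S where "S = closed_segment (of_nat (Suc n)) (of_nat (Suc (Suc n)) :: complex)"
  define B where "B = norm (\<Prod>j<Suc K. a - of_nat j) * real (Suc n) powr (- Re s - real K)"
  have S: "\<exists>r. x = of_real r \<and> r \<ge> real (Suc n)" if "x \<in> S" for x
  proof -
    have "S = of_real ` closed_segment (real (Suc n)) (real (Suc (Suc n)))"
      unfolding S_def closed_segment_of_real[symmetric] of_real_of_nat_eq ..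
    with that show ?thesis by (auto simp: closed_segment_eq_real_ivl)
  qed
  have "cmod (f 0 (of_nat (Suc (Suc n))) -
      (\<Sum>i\<le>K. f i (of_nat (Suc n)) * (of_nat (Suc (Suc n)) - of_nat (Suc n)) ^ i / fact i))
     \<le> B * cmod (of_nat (Suc (Suc n)) - of_nat (Suc n)) ^ Suc K / fact K"
  proof (rule complex_Taylor)
    show "convex S" by (simp add: S_def)
    show "of_nat (Suc n) \<in> S" "of_nat (Suc (Suc n)) \<in> S" by (auto simp: S_def)
    fix x assume "x \<in> S"
    then obtain r where r: "x = of_real r" "r \<ge> real (Suc n)" using S by blast
    have "r > 0" using r(2) by simp
    then have x: "x \<notin> \<real>\<^sub>\<le>\<^sub>0" using r by simp
    show "(f i has_field_derivative f (Suc i) x) (at x within S)" for i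
    proof -
      have e: "a - of_nat i - 1 = a - of_nat (Suc i)" by simp
      have "((\<lambda>x. x powr (a - of_nat i)) has_field_derivative
          (a - of_nat i) * x powr (a - of_nat (Suc i))) (at x within S)"
        using has_field_derivative_at_within
            [OF has_field_derivative_powr[OF x, of "a - of_nat i"], of S]
        unfolding e .
      from DERIV_cmult[OF this, of "\<Prod>j<i. a - of_nat j"] show ?thesis
        unfolding f_def prod.lessThan_Suc mult.assoc .
    qed
    have "cmod (x powr (a - of_nat (Suc K))) = r powr (Re a - real (Suc K))"
      using norm_powr_real_powr[of x] r \<open>r > 0\<close> by (simp del: of_nat_Suc)
    also have "\<dots> \<le> real (Suc n) powr (- Re s - real K)"
      using r assms by (simp add: a_def powr_mono2')
    finally show "cmod (f (Suc K) x) \<le> B"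
      unfolding f_def B_def norm_mult by (intro mult_left_mono) auto
  qed
  also have "\<dots> = B / fact K" by simp
  also have "\<dots> \<le> B / 1" by (intro divide_left_mono) (simp_all add: B_def fact_ge_1)
  also have "f 0 (of_nat (Suc (Suc n))) -
      (\<Sum>i\<le>K. f i (of_nat (Suc n)) * (of_nat (Suc (Suc n)) - of_nat (Suc n)) ^ i / fact i)
      = - zeta_rem K n s"
  proof -
    have "of_nat (Suc (Suc n)) - of_nat (Suc n) = (1::complex)" by simp
    moreover have "f i x / fact i = (a gchoose i) * x powr (a - of_nat i)" for i x
      by (simp add: f_def gbinomial_prod_rev atLeast0LessThan)
    moreover have "f 0 x = x powr a" for x by (simp add: f_def)
    ultimately show ?thesis
      by (simp only: zeta_rem_def a_def[symmetric] power_one mult_1_right minus_diff_eq)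
  qed
  finally show ?thesis unfolding B_def a_def norm_minus_cancel by simp
qed

lemma zeta_rem_sum_holomorphic:
  "(\<lambda>s. \<Sum>n. zeta_rem K n s) holomorphic_on {s. Re s > 1 - real K}"
proof (rule holomorphic_suminf_local_M_test)
  show "open {s. Re s > 1 - real K}" by (rule open_halfspace_Re_gt)
  show "zeta_rem K n holomorphic_on {s. Re s > 1 - real K}" for n
    unfolding zeta_rem_def gbinomial_prod_rev
    by (intro holomorphic_on_diff holomorphic_on_sum holomorphic_on_mult holomorphic_on_divide
        holomorphic_on_prod holomorphic_on_powr_right holomorphic_on_const holomorphic_on_ident)
      (simp_all del: of_nat_Suc)
  fix x assume "x \<in> {s. Re s > 1 - real K}"
  then obtain d \<sigma> where d: "d > 0" "\<sigma> > 1 - real K" "\<And>z. z \<in> cball x d \<Longrightarrow> Re z \<ge> \<sigma>"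
    using halfplane_cball[of "1 - real K" x] by auto
  let ?p = "\<lambda>s::complex. \<Prod>j<Suc K. 1 - s - of_nat j"
  have "compact (?p ` cball x d)"
    by (intro compact_continuous_image continuous_intros) auto
  then obtain C where C: "\<And>z. z \<in> cball x d \<Longrightarrow> norm (?p z) \<le> C"
    using compact_imp_bounded[of "?p ` cball x d"] unfolding bounded_iff by blast
  have "norm (zeta_rem K n z) \<le> C * real (Suc n) powr (- \<sigma> - real K)"
    if "z \<in> cball x d" for n z
  proof -
    have "norm (zeta_rem K n z) \<le> norm (?p z) * real (Suc n) powr (- Re z - real K)"
      using d(2) d(3)[OF that] by (intro zeta_rem_bound) auto
    also have "\<dots> \<le> C * real (Suc n) powr (- \<sigma> - real K)"
      using d(3)[OF that] C[OF that] order.trans[OF norm_ge_zero C[OF that]]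
      by (intro mult_mono powr_mono) auto
    finally show ?thesis .
  qed
  moreover have "summable (\<lambda>n. C * real (Suc n) powr (- \<sigma> - real K))"
    using d by (intro summable_mult summable_Suc_powr) auto
  moreover have "cball x d \<subseteq> {s. Re s > 1 - real K}" using d(2,3) by fastforce
  ultimately show "\<exists>d>0. cball x d \<subseteq> {s. Re s > 1 - real K} \<and>
      (\<exists>M. summable M \<and> (\<forall>n. \<forall>z\<in>cball x d. norm (zeta_rem K n z) \<le> M n))"
    using d(1) by blast
qed

lemma zeta_rem_sums:
  assumes "Re s > 1"
  shows "(\<lambda>n. zeta_rem K n s) sums
           (1 + (\<Sum>k=1..K. ((1 - s) gchoose k) * dirichlet_zeta (s + of_nat k - 1)))"
proof -
  have lim: "(\<lambda>n. of_nat (Suc n) powr (1 - s)) \<longlonglongrightarrow> (0::complex)"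
  proof (rule tendsto_norm_zero_cancel, unfold norm_nat_powr)
    have "(\<lambda>n. real n powr Re (1 - s)) \<longlonglongrightarrow> 0"
      using assms by (intro tendsto_neg_powr filterlim_real_sequentially) auto
    then show "(\<lambda>n. real (Suc n) powr Re (1 - s)) \<longlonglongrightarrow> 0"
      by (rule LIMSEQ_Suc)
  qed
  have 1: "(\<lambda>n. of_nat (Suc n) powr (1 - s) - of_nat (Suc (Suc n)) powr (1 - s)) sums (1::complex)"
    using telescope_sums'[OF lim] by simp
  have 2: "(\<lambda>n. \<Sum>k=1..K. ((1 - s) gchoose k) * of_nat (Suc n) powr (1 - s - of_nat k)) sums
      (\<Sum>k=1..K. ((1 - s) gchoose k) * dirichlet_zeta (s + of_nat k - 1))"
  proof (intro sums_sum sums_mult)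
    fix k assume "k \<in> {1..K}"
    then have "Re (s + of_nat k - 1) > 1" using assms by auto
    from dirichlet_zeta_sums[OF this]
    show "(\<lambda>n. of_nat (Suc n) powr (1 - s - of_nat k)) sums dirichlet_zeta (s + of_nat k - 1)"
      by (simp add: algebra_simps del: of_nat_Suc)
  qed
  have "zeta_rem K n s = of_nat (Suc n) powr (1 - s) - of_nat (Suc (Suc n)) powr (1 - s) +
      (\<Sum>k=1..K. ((1 - s) gchoose k) * of_nat (Suc n) powr (1 - s - of_nat k))" for n
  proof -
    have "{..K} = insert 0 {1..K}" by auto
    then show ?thesis unfolding zeta_rem_def by (simp del: of_nat_Suc)
  qed
  then show ?thesis by (simp only: sums_add[OF 1 2])
qed

lemma zeta_continuation_halfplane:
  "\<exists>g. g holomorphic_on {s. Re s > 1 - real N} \<and>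
       (\<forall>s. Re s > 1 \<longrightarrow> g s = (s - 1) * dirichlet_zeta s)"
proof (induction N)
  case 0
  show ?case
  proof (intro exI conjI allI impI)
    show "(\<lambda>s. (s - 1) * dirichlet_zeta s) holomorphic_on {s. Re s > 1 - real 0}"
      using dirichlet_zeta_holomorphic
      by (intro holomorphic_on_mult holomorphic_on_diff holomorphic_on_ident holomorphic_on_const) simp
  qed (rule refl)
next
  case (Suc N)
  then obtain g where g: "g holomorphic_on {s. Re s > 1 - real N}"
    and g_eq: "\<And>s. Re s > 1 \<Longrightarrow> g s = (s - 1) * dirichlet_zeta s" by blast
  define G where "G = (\<lambda>s. 1 - (\<Sum>j=1..N. ((1 - s) gchoose j) / of_nat (Suc j) * g (s + of_nat j))
      - (\<Sum>n. zeta_rem (Suc N) n s))"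
  have "G holomorphic_on {s. Re s > 1 - real (Suc N)}"
  proof -
    let ?A = "{s. Re s > 1 - real (Suc N)}"
    have shift: "(\<lambda>s. g (s + of_nat j)) holomorphic_on ?A" if "j \<in> {1..N}" for j
    proof -
      have "(\<lambda>s. s + of_nat j) holomorphic_on ?A"
        by (intro holomorphic_on_add holomorphic_on_ident holomorphic_on_const)
      moreover have "(\<lambda>s. s + of_nat j) ` ?A \<subseteq> {s. Re s > 1 - real N}"
        using that by auto
      ultimately have "(g \<circ> (\<lambda>s. s + of_nat j)) holomorphic_on ?A"
        by (intro holomorphic_on_compose_gen[OF _ g])
      then show ?thesis by (simp only: o_def)
    qed
    have binom: "(\<lambda>s. ((1 - s) gchoose j)) holomorphic_on ?A" for j
      unfolding gbinomial_prod_rev by (intro holomorphic_intros) auto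
    show ?thesis
      unfolding G_def
      by (intro holomorphic_on_diff holomorphic_on_const holomorphic_on_sum holomorphic_on_mult
          holomorphic_on_divide binom shift zeta_rem_sum_holomorphic) (simp_all del: of_nat_Suc)
  qed
  moreover have "G s = (s - 1) * dirichlet_zeta s" if s: "Re s > 1" for s
  proof -
    have "(\<Sum>n. zeta_rem (Suc N) n s) =
        1 + (\<Sum>k=1..Suc N. ((1 - s) gchoose k) * dirichlet_zeta (s + of_nat k - 1))"
      using zeta_rem_sums[OF s, of "Suc N"] by (simp add: sums_iff)
    also have "(\<Sum>k=1..Suc N. ((1 - s) gchoose k) * dirichlet_zeta (s + of_nat k - 1)) =
        (1 - s) * dirichlet_zeta s +
        (\<Sum>j=1..N. ((1 - s) gchoose Suc j) * dirichlet_zeta (s + of_nat j))"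
      by (subst sum.atLeast_Suc_atMost, simp, subst sum.shift_bounds_cl_Suc_ivl) simp
    also have "(\<Sum>j=1..N. ((1 - s) gchoose Suc j) * dirichlet_zeta (s + of_nat j)) =
        - (\<Sum>j=1..N. ((1 - s) gchoose j) / of_nat (Suc j) * g (s + of_nat j))"
      unfolding sum_negf[symmetric]
    proof (rule sum.cong[OF refl])
      have key: "x * (1 - s - k) * d = - (x * ((s + k - 1) * d))" for x k d :: complex
        by (simp add: algebra_simps)
      fix j assume "j \<in> {1..N}"
      then have gj: "g (s + of_nat j) = (s + of_nat j - 1) * dirichlet_zeta (s + of_nat j)"
        using s by (intro g_eq) auto
      have gS: "((1 - s) gchoose Suc j) =
          ((1 - s) gchoose j) / of_nat (Suc j) * (1 - s - of_nat j)"
      proof -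
        have "of_nat (Suc j) * ((1 - s) gchoose Suc j) = ((1 - s) gchoose j) * (1 - s - of_nat j)"
          using gbinomial_mult_1[of "1 - s" j] by (simp add: algebra_simps del: of_nat_Suc)
        then show ?thesis
          using of_nat_neq_0[of j, where 'a=complex]
          by (simp add: eq_divide_eq mult.commute del: of_nat_Suc)
      qed
      show "((1 - s) gchoose Suc j) * dirichlet_zeta (s + of_nat j) =
          - (((1 - s) gchoose j) / of_nat (Suc j) * g (s + of_nat j))"
        unfolding gS gj by (rule key)
    qed
    finally have "G s = - ((1 - s) * dirichlet_zeta s)"
      unfolding G_def by (simp only:) simp
    then show ?thesis by (simp add: algebra_simps)
  qed
  ultimately show ?case by (intro exI[of _ G] conjI) simp_all
qed

lemma zeta_continuation_unique:
  assumes "is_zeta_continuation f" "is_zeta_continuation g"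
  shows "f = g"
proof
  fix s
  show "f s = g s"
  proof (cases "s = 1")
    case False
    show ?thesis
    proof (rule analytic_continuation_open[of "{s. Re s > 1}" "- {1}" f g])
      show "{s. Re s > 1} \<noteq> {}" by (auto intro!: exI[of _ 2])
      show "connected (- {1::complex})"
        by (rule connected_punctured_universe) simp
      show "f z = g z" if "z \<in> {s. Re s > 1}" for z
      proof (rule sums_unique2)
        show "(\<lambda>n. 1 / of_nat (Suc n) powr z) sums f z" "(\<lambda>n. 1 / of_nat (Suc n) powr z) sums g z"
          using assms that by (simp_all add: is_zeta_continuation_def)
      qed
    qed (use assms False in \<open>auto simp: is_zeta_continuation_def open_halfspace_Re_gt\<close>)
  next
    case True
    with assms show ?thesis by (simp add: is_zeta_continuation_def)
  qed
qed

lemma zeta_continuation_exists: "\<exists>f. is_zeta_continuation f"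
proof -
  define H where "H = (\<lambda>N. {s. Re s > 1 - real N})"
  obtain g where g: "\<And>N. g N holomorphic_on H N"
    and g_eq: "\<And>N s. Re s > 1 \<Longrightarrow> g N s = (s - 1) * dirichlet_zeta s"
    using zeta_continuation_halfplane unfolding H_def by metis
  have opH: "open (H N)" for N unfolding H_def by (rule open_halfspace_Re_gt)
  have mono: "H M \<subseteq> H N" if "M \<le> N" for M N using that by (auto simp: H_def)
  have agree: "g M s = g N s" if "M \<le> N" "s \<in> H M" for M N s
  proof (rule analytic_continuation_open[of "{s. Re s > 1}" "H M" "g M" "g N"])
    show "{s. Re s > 1} \<noteq> {}" by (auto intro!: exI[of _ 2])
    show "connected (H M)" unfolding H_def by (intro convex_connected convex_halfspace_Re_gt)
    show "g N holomorphic_on H M" using g[of N] mono[OF that(1)] by (rule holomorphic_on_subset)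
  qed (use g g_eq opH that in \<open>auto simp: H_def open_halfspace_Re_gt\<close>)
  define idx where "idx = (\<lambda>s. nat \<lceil>2 - Re s\<rceil>)"
  have idx: "s \<in> H (idx s)" for s
    unfolding H_def idx_def mem_Collect_eq by linarith
  define Z where "Z = (\<lambda>s. g (idx s) s / (s - 1))"
  have Z_eq: "Z s = g N s / (s - 1)" if "s \<in> H N" for s N
  proof -
    have "g (idx s) s = g N s"
    proof (cases "N \<le> idx s")
      case True
      then show ?thesis using agree[OF True that] by simp
    next
      case False
      then show ?thesis using agree[OF _ idx] by simp
    qed
    then show ?thesis by (simp only: Z_def)
  qed
  have "Z holomorphic_on (\<Union>N. H N - {1})"
  proof (rule holomorphic_on_UN_open)
    show "Z holomorphic_on H N - {1}" for N
    proof (rule holomorphic_transform)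
      show "(\<lambda>s. g N s / (s - 1)) holomorphic_on H N - {1}"
        by (intro holomorphic_intros holomorphic_on_subset[OF g]) auto
    qed (use Z_eq in auto)
    show "open (H N - {1})" for N using opH by (intro open_Diff) auto
  qed
  moreover have "(\<Union>N. H N - {1}) = - {1}" using idx by blast
  moreover have "Z 1 = 0" by (simp add: Z_def)
  moreover have "(\<lambda>n. 1 / of_nat (Suc n) powr s) sums Z s" if "Re s > 1" for s
  proof -
    have "Z s = dirichlet_zeta s"
      using g_eq[OF that] that by (auto simp: Z_def)
    with dirichlet_zeta_sums[OF that] show ?thesis
      by (simp add: powr_minus_divide del: of_nat_Suc)
  qed
  ultimately have "is_zeta_continuation Z" by (auto simp: is_zeta_continuation_def)
  then show ?thesis by blast
qed

lemma ex1_zeta_continuation: "\<exists>!f. is_zeta_continuation f"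
  using zeta_continuation_exists zeta_continuation_unique by blast

lemma is_zeta_continuation_zeta: "is_zeta_continuation zeta"
  unfolding zeta_def by (rule theI'[OF ex1_zeta_continuation])

lemma zeta_cnj: "zeta (cnj s) = cnj (zeta s)"
proof -
  have Z: "is_zeta_continuation zeta" by (rule is_zeta_continuation_zeta)
  have "is_zeta_continuation (cnj \<circ> zeta \<circ> cnj)"
    unfolding is_zeta_continuation_def
  proof (intro conjI allI impI)
    have "cnj ` (- {1}) = - {1}"
    proof (intro equalityI subsetI)
      fix z :: complex assume "z \<in> - {1}"
      then show "z \<in> cnj ` (- {1})" by (intro image_eqI[of _ _ "cnj z"]) auto
    qed auto
    then show "cnj \<circ> zeta \<circ> cnj holomorphic_on - {1}"
      using Z holomorphic_on_compose_cnj_cnj[of zeta "- {1}"]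
      by (auto simp: is_zeta_continuation_def)
    show "(cnj \<circ> zeta \<circ> cnj) 1 = 0" using Z by (simp add: is_zeta_continuation_def)
    fix s assume "Re s > 1"
    then have "(\<lambda>n. 1 / of_nat (Suc n) powr cnj s) sums zeta (cnj s)"
      using Z by (simp add: is_zeta_continuation_def)
    then have "(\<lambda>n. cnj (1 / of_nat (Suc n) powr cnj s)) sums cnj (zeta (cnj s))"
      by (simp only: sums_cnj)
    moreover have "cnj (1 / of_nat (Suc n) powr cnj s) = 1 / of_nat (Suc n) powr s" for n
      by (simp add: cnj_powr del: of_nat_Suc)
    ultimately show "(\<lambda>n. 1 / of_nat (Suc n) powr s) sums (cnj \<circ> zeta \<circ> cnj) s" by simp
  qed
  from zeta_continuation_unique[OF Z this] have "zeta (cnj s) = (cnj \<circ> zeta \<circ> cnj) (cnj s)"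
    by simp
  then show ?thesis by simp
qed

lemma zeta_of_real: "zeta (of_real x) = of_real (Re (zeta (of_real x)))"
  using zeta_cnj[of "of_real x"] by (simp add: complex_eq_iff)

subsection \<open>The Caputo derivative of order \<open>0 < \<alpha> < 1\<close>\<close>

definition caputo_deriv :: "real \<Rightarrow> (real \<Rightarrow> real) \<Rightarrow> real \<Rightarrow> real" where
  "caputo_deriv \<alpha> y t =
     1 / Gamma (1 - \<alpha>) * integral {0..t} (\<lambda>x. deriv y x / (t - x) powr \<alpha>)"

end

theory Submission
  imports Defs
begin

text \<open>
  After rescaling to step size \<open>1\<close> and summation by parts, the scheme integrates
  \<open>(1 - \<alpha>) * (n - x) powr (- \<alpha>)\<close> over \<open>[0, n]\<close> against the derivative of the piecewise linear
  interpolant \<open>p\<close> of \<open>f x = x powr \<beta>\<close>. Integrating the difference to the Caputo derivative by parts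
  turns the error into the integral of \<open>- \<alpha> * (1 - \<alpha>) * (p x - f x) * (n - x) powr (- 1 - \<alpha>)\<close>.
  Near \<open>x = 0\<close> the kernel is almost the constant \<open>n powr (- 1 - \<alpha>)\<close>, and the integral of \<open>p - f\<close> is
  the total error of the trapezoidal rule for \<open>f\<close>, which for \<open>\<beta> < 1\<close> converges to \<open>zeta (- \<beta>)\<close>.
  Everything else is \<open>O(n powr (\<beta> - 2))\<close>, because \<open>\<bar>p - f\<bar> = O((j + 1) powr (\<beta> - 2))\<close> on \<open>[j, j + 1]\<close>.
\<close>

section \<open>Linear interpolation of \<open>x powr \<beta>\<close> on unit intervals\<close>

definition interp_err :: "real \<Rightarrow> nat \<Rightarrow> real \<Rightarrow> real" where
  "interp_err \<beta> j x =
     real j powr \<beta> + (x - real j) * (real (Suc j) powr \<beta> - real j powr \<beta>) - x powr \<beta>"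

text \<open>The sign is rule minus exact integral, so that this is the integral of
  \<open>interp_err\<close> and, for \<open>\<beta> < 1\<close>, the series is
  \<open>zeta (- \<beta>)\<close> without a change of sign.\<close>

definition trapezoid_err :: "real \<Rightarrow> nat \<Rightarrow> real" where
  "trapezoid_err \<beta> j = (real j powr \<beta> + real (Suc j) powr \<beta>) / 2
     - (real (Suc j) powr (\<beta> + 1) - real j powr (\<beta> + 1)) / (\<beta> + 1)"

lemma interp_err_has_real_derivative:
  assumes "x > 0"
  shows "(interp_err \<beta> j has_real_derivative
            real (Suc j) powr \<beta> - real j powr \<beta> - \<beta> * x powr (\<beta> - 1)) (at x within S)"
proof (rule has_field_derivative_at_within)
  show "(interp_err \<beta> j has_real_derivative
            real (Suc j) powr \<beta> - real j powr \<beta> - \<beta> * x powr (\<beta> - 1)) (at x)"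
    unfolding interp_err_def using assms
    by (auto intro!: derivative_eq_intros simp del: of_nat_Suc)
qed

lemma continuous_on_interp_err:
  assumes "\<beta> > 0" "S \<subseteq> {0..}"
  shows "continuous_on S (interp_err \<beta> j)"
  unfolding interp_err_def using assms
  by (intro continuous_on_diff continuous_on_add continuous_on_mult continuous_on_const
      continuous_on_id continuous_on_powr') auto

lemma interp_err_nodes [simp]: "interp_err \<beta> j (real j) = 0" "interp_err \<beta> j (real (Suc j)) = 0"
  by (simp_all add: interp_err_def algebra_simps)

lemma interp_err_has_integral:
  assumes "\<beta> > 0"
  shows "(interp_err \<beta> j has_integral trapezoid_err \<beta> j) {real j..real (Suc j)}"
proof -
  define u v where "u = real j powr \<beta>" and "v = real (Suc j) powr \<beta> - real j powr \<beta>"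
  define F where "F = (\<lambda>x. x * u + (x - real j)\<^sup>2 / 2 * v - x powr (\<beta> + 1) / (\<beta> + 1))"
  have interp_err_uv: "interp_err \<beta> j x = u + (x - real j) * v - x powr \<beta>" for x
    by (simp only: interp_err_def u_def v_def)
  have "(interp_err \<beta> j has_integral (F (real (Suc j)) - F (real j))) {real j..real (Suc j)}"
  \<comment> \<open>For \<open>j = 0\<close> the left endpoint is 0, where the power rule, which
    asks for \<open>x > 0\<close>, does not apply; continuity of \<open>F\<close> suffices
    there.\<close>
  proof (rule fundamental_theorem_of_calculus_interior)
    show "continuous_on {real j..real (Suc j)} F"
      unfolding F_def using assms by (intro continuous_intros continuous_on_powr') auto
    fix x assume "x \<in> {real j<..<real (Suc j)}"
    then have "x > 0" by auto
    then show "(F has_vector_derivative interp_err \<beta> j x) (at x)"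
      unfolding F_def interp_err_uv has_real_derivative_iff_has_vector_derivative[symmetric]
      using assms by (auto intro!: derivative_eq_intros)
  qed simp
  moreover have "F (real (Suc j)) - F (real j) = trapezoid_err \<beta> j"
    unfolding F_def trapezoid_err_def u_def v_def
    by (simp add: algebra_simps add_divide_distrib diff_divide_distrib)
  ultimately show ?thesis by simp
qed

text \<open>The ratio \<open>q = w / N\<close> lies in \<open>[1/2, 1]\<close>, so
  \<open>q powr c\<close> is at most 1 for \<open>c \<ge> 0\<close> and at most
  \<open>(1/2) powr c\<close> otherwise. The absolute value lets one bound serve exponents of either
  sign.\<close>

lemma powr_le_within_factor_two:
  fixes w N c :: real
  assumes "0 < w" "w \<le> N" "N \<le> 2 * w"
  shows "w powr c \<le> 2 powr \<bar>c\<bar> * N powr c"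
proof -
  define q where "q = w / N"
  have q: "1 / 2 \<le> q" "q \<le> 1" and wq: "w = q * N"
    using assms by (auto simp: q_def field_simps)
  have "q powr c \<le> 2 powr \<bar>c\<bar>"
  proof (cases "c \<ge> 0")
    case True
    have "q powr c \<le> 1" using q True by (intro powr_le1) auto
    also have "\<dots> \<le> 2 powr \<bar>c\<bar>" by (intro ge_one_powr_ge_zero) auto
    finally show ?thesis .
  next
    case False
    have "q powr c \<le> (1 / 2) powr c"
      using q False by (intro powr_mono2') auto
    also have "\<dots> = 2 powr \<bar>c\<bar>"
      using False by (simp add: powr_divide powr_minus_divide)
    finally show ?thesis .
  qed
  then show ?thesis
    unfolding wq using q assms by (subst powr_mult) (auto intro!: mult_right_mono)
qed

text \<open>The first summand comes from the second derivative of \<open>x powr \<beta>\<close> on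
  \<open>[j, j + 1]\<close> with \<open>j \<ge> 1\<close>. The 1 covers \<open>j = 0\<close>, where
  that derivative may be unbounded but the interpolation error is at most 1.\<close>

definition interp_const :: "real \<Rightarrow> real" where
  "interp_const \<beta> = \<beta> * \<bar>\<beta> - 1\<bar> * 2 powr \<bar>\<beta> - 2\<bar> + 1"

text \<open>By the mean value theorem the slope is the derivative at some \<open>z\<close> in the
  interval, and moving from \<open>z\<close> to \<open>x\<close> costs at most the maximal curvature
  times a length of at most 1. Since \<open>j \<ge> 1\<close> gives
  \<open>j + 1 \<le> 2 * j\<close>, \<open>powr_le_within_factor_two\<close> carries the curvature
  over to \<open>j + 1\<close>.\<close>

lemma slope_error_bound:
  assumes "\<beta> > 0" "j \<ge> 1" "x \<in> {real j..real (Suc j)}"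
  shows "\<bar>real (Suc j) powr \<beta> - real j powr \<beta> - \<beta> * x powr (\<beta> - 1)\<bar>
           \<le> \<beta> * \<bar>\<beta> - 1\<bar> * 2 powr \<bar>\<beta> - 2\<bar> * real (Suc j) powr (\<beta> - 2)"
proof -
  have curv: "\<bar>\<beta> * (\<beta> - 1) * w powr (\<beta> - 2)\<bar>
      \<le> \<beta> * \<bar>\<beta> - 1\<bar> * 2 powr \<bar>\<beta> - 2\<bar> * real (Suc j) powr (\<beta> - 2)"
    if w: "w \<in> {real j..real (Suc j)}" for w
  proof -
    have "w > 0" using w \<open>j \<ge> 1\<close> by auto
    then have "w powr (\<beta> - 2) \<le> 2 powr \<bar>\<beta> - 2\<bar> * real (Suc j) powr (\<beta> - 2)"
      using w \<open>j \<ge> 1\<close> by (intro powr_le_within_factor_two) auto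
    then have "\<beta> * \<bar>\<beta> - 1\<bar> * w powr (\<beta> - 2)
        \<le> \<beta> * \<bar>\<beta> - 1\<bar> * (2 powr \<bar>\<beta> - 2\<bar> * real (Suc j) powr (\<beta> - 2))"
      using \<open>\<beta> > 0\<close> by (intro mult_left_mono) auto
    then show ?thesis
      using \<open>\<beta> > 0\<close> by (simp add: abs_mult mult.assoc)
  qed
  have "\<exists>z. z > real j \<and> z < real (Suc j) \<and>
      real (Suc j) powr \<beta> - real j powr \<beta> = (real (Suc j) - real j) * (\<beta> * z powr (\<beta> - 1))"
  proof (rule MVT2)
    fix w assume "real j \<le> w" "w \<le> real (Suc j)"
    then show "((\<lambda>x. x powr \<beta>) has_real_derivative \<beta> * w powr (\<beta> - 1)) (at w)"
      using \<open>j \<ge> 1\<close> by (intro has_real_derivative_powr) auto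
  qed simp
  then obtain z where "z > real j" "z < real (Suc j)"
    and "real (Suc j) powr \<beta> - real j powr \<beta> = (real (Suc j) - real j) * (\<beta> * z powr (\<beta> - 1))"
    by blast
  then have z: "z \<in> {real j..real (Suc j)}"
    and ez: "real (Suc j) powr \<beta> - real j powr \<beta> = \<beta> * z powr (\<beta> - 1)"
    by auto
  have "norm ((\<lambda>w. \<beta> * w powr (\<beta> - 1)) z - (\<lambda>w. \<beta> * w powr (\<beta> - 1)) x)
      \<le> \<beta> * \<bar>\<beta> - 1\<bar> * 2 powr \<bar>\<beta> - 2\<bar> * real (Suc j) powr (\<beta> - 2) * norm (z - x)"
  proof (rule field_differentiable_bound[of "{real j..real (Suc j)}"])
    fix w assume w: "w \<in> {real j..real (Suc j)}"
    then have "w > 0" using \<open>j \<ge> 1\<close> by auto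
    then have "((\<lambda>w. \<beta> * w powr (\<beta> - 1)) has_field_derivative \<beta> * (\<beta> - 1) * w powr (\<beta> - 2)) (at w)"
      by (auto intro!: derivative_eq_intros)
    then show "((\<lambda>w. \<beta> * w powr (\<beta> - 1)) has_field_derivative \<beta> * (\<beta> - 1) * w powr (\<beta> - 2))
        (at w within {real j..real (Suc j)})"
      by (rule has_field_derivative_at_within)
    show "norm (\<beta> * (\<beta> - 1) * w powr (\<beta> - 2))
        \<le> \<beta> * \<bar>\<beta> - 1\<bar> * 2 powr \<bar>\<beta> - 2\<bar> * real (Suc j) powr (\<beta> - 2)"
      using curv[OF w] by simp
  qed (use z assms in auto)
  also have "\<dots> \<le> \<beta> * \<bar>\<beta> - 1\<bar> * 2 powr \<bar>\<beta> - 2\<bar> * real (Suc j) powr (\<beta> - 2) * 1"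
    using z assms by (intro mult_left_mono) auto
  finally show ?thesis unfolding ez by simp
qed

text \<open>For \<open>j \<ge> 1\<close> the error vanishes at the node \<open>j\<close> and its
  derivative is the slope error, so the slope bound carries over across a length of at most
  1.\<close>

lemma interp_err_bound:
  assumes "\<beta> > 0" "x \<in> {real j..real (Suc j)}"
  shows "\<bar>interp_err \<beta> j x\<bar> \<le> interp_const \<beta> * real (Suc j) powr (\<beta> - 2)"
proof (cases "j = 0")
  case True
  then have x: "x \<in> {0..1}" using assms by auto
  have "0 \<le> x powr \<beta>" "x powr \<beta> \<le> 1" using x assms by (auto intro: powr_le1)
  moreover have "interp_err \<beta> j x = x - x powr \<beta>" by (simp add: interp_err_def True)
  moreover have "0 \<le> x" "x \<le> 1" using x by auto
  ultimately have "\<bar>interp_err \<beta> j x\<bar> \<le> 0 + 1" by linarith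
  also have "\<dots> \<le> (\<beta> * \<bar>\<beta> - 1\<bar> * 2 powr \<bar>\<beta> - 2\<bar> + 1)"
    using assms by (intro add_mono) auto
  finally show ?thesis using True by (simp add: interp_const_def)
next
  case False
  define B where "B = \<beta> * \<bar>\<beta> - 1\<bar> * 2 powr \<bar>\<beta> - 2\<bar> * real (Suc j) powr (\<beta> - 2)"
  have "B \<ge> 0" using assms by (simp add: B_def)
  have "norm (interp_err \<beta> j x - interp_err \<beta> j (real j)) \<le> B * norm (x - real j)"
  proof (rule field_differentiable_bound[of "{real j..real (Suc j)}"])
    fix w assume w: "w \<in> {real j..real (Suc j)}"
    then have "w > 0" using False by auto
    then show "(interp_err \<beta> j has_field_derivative
            real (Suc j) powr \<beta> - real j powr \<beta> - \<beta> * w powr (\<beta> - 1)) (at w within {real j..real (Suc j)})"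
      by (rule interp_err_has_real_derivative)
    show "norm (real (Suc j) powr \<beta> - real j powr \<beta> - \<beta> * w powr (\<beta> - 1)) \<le> B"
      unfolding B_def real_norm_def using False w assms by (intro slope_error_bound) auto
  qed (use assms in auto)
  also have "\<dots> \<le> B * 1"
    using assms \<open>B \<ge> 0\<close> by (intro mult_left_mono) auto
  also have "\<dots> \<le> (\<beta> * \<bar>\<beta> - 1\<bar> * 2 powr \<bar>\<beta> - 2\<bar> + 1) * real (Suc j) powr (\<beta> - 2)"
    by (simp add: B_def algebra_simps)
  finally show ?thesis by (simp add: interp_const_def)
qed

section \<open>Error of the scheme on a single interval\<close>

lemma has_integral_powr_from_end:
  assumes "0 < \<alpha>" "\<alpha> < 1" "a \<le> b" "b \<le> (c :: real)"
  shows "((\<lambda>x. (1 - \<alpha>) * (c - x) powr (- \<alpha>)) has_integral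
           ((c - a) powr (1 - \<alpha>) - (c - b) powr (1 - \<alpha>))) {a..b}"
proof -
  have "((\<lambda>x. (1 - \<alpha>) * (c - x) powr (- \<alpha>)) has_integral
           (- ((c - b) powr (1 - \<alpha>)) - - ((c - a) powr (1 - \<alpha>)))) {a..b}"
  \<comment> \<open>When \<open>b = c\<close> the derivative blows up at the right endpoint; the
    antiderivative stays continuous because \<open>1 - \<alpha> > 0\<close>.\<close>
  proof (rule fundamental_theorem_of_calculus_interior)
    show "continuous_on {a..b} (\<lambda>x. - ((c - x) powr (1 - \<alpha>)))"
      using assms by (intro continuous_intros continuous_on_powr') auto
    fix x assume "x \<in> {a<..<b}"
    then have "c - x > 0" using assms by auto
    then show "((\<lambda>x. - ((c - x) powr (1 - \<alpha>))) has_vector_derivative (1 - \<alpha>) * (c - x) powr (- \<alpha>)) (at x)"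
      unfolding has_real_derivative_iff_has_vector_derivative[symmetric]
      by (auto intro!: derivative_eq_intros)
  qed fact
  then show ?thesis by simp
qed

text \<open>
  The error of the \<open>j\<close>-th interval when the integrand \<open>\<beta> * x powr (\<beta> - 1)\<close> is replaced by the slope of
  the interpolant, at unit step size.
\<close>

definition l1_err :: "real \<Rightarrow> real \<Rightarrow> nat \<Rightarrow> nat \<Rightarrow> real" where
  "l1_err \<alpha> \<beta> n j =
     (real (n - j) powr (1 - \<alpha>) - real (n - Suc j) powr (1 - \<alpha>)) * (real (Suc j) powr \<beta> - real j powr \<beta>)
     - (1 - \<alpha>) * integral {real j..real (Suc j)} (\<lambda>x. \<beta> * x powr (\<beta> - 1) * (real n - x) powr (- \<alpha>))"

text \<open>Integration by parts: the boundary terms vanish because \<open>interp_err\<close> is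
  zero at both nodes. \<open>Suc j < n\<close> keeps \<open>n - x\<close> positive, hence the kernel
  continuous; the last interval is treated separately.\<close>

lemma l1_err_eq_integral:
  assumes "0 < \<alpha>" "\<alpha> < 1" "\<beta> > 0" "Suc j < n"
  shows "((\<lambda>x. interp_err \<beta> j x * (real n - x) powr (- 1 - \<alpha>)) has_integral
            - l1_err \<alpha> \<beta> n j / (\<alpha> * (1 - \<alpha>))) {real j..real (Suc j)}"
proof -
  define b where "b = real (Suc j) powr \<beta> - real j powr \<beta>"
  define I where "I = {real j..real (Suc j)}"
  define e where "e = (\<lambda>x. interp_err \<beta> j x * (real n - x) powr (- 1 - \<alpha>))"
  define F where "F = (\<lambda>x. interp_err \<beta> j x * (real n - x) powr (- \<alpha>))"
  define a where "a = real (n - j) powr (1 - \<alpha>) - real (n - Suc j) powr (1 - \<alpha>)"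
  have n: "real n - x > 0" if "x \<in> I" for x using that assms by (auto simp: I_def)
  have cont: "continuous_on I (interp_err \<beta> j)"
    using assms by (intro continuous_on_interp_err) (auto simp: I_def)
  have "continuous_on I e"
    unfolding e_def using n by (intro continuous_intros cont continuous_on_powr) fastforce+
  then have e: "(e has_integral integral I e) I"
    unfolding I_def by (intro integrable_integral integrable_continuous_real)
  \<comment> \<open>For \<open>j = 0\<close> and \<open>\<beta> < 1\<close> this integrand is
    unbounded at 0, so its integrability is read off from the antiderivative \<open>F\<close> and
    not from continuity.\<close>
  have "((\<lambda>x. (b - \<beta> * x powr (\<beta> - 1)) * (real n - x) powr (- \<alpha>) + \<alpha> * e x) has_integral
          F (real (Suc j)) - F (real j)) I"
    unfolding I_def
  proof (rule fundamental_theorem_of_calculus_interior)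
    show "continuous_on {real j..real (Suc j)} F"
      unfolding F_def I_def[symmetric] using n by (intro continuous_intros cont continuous_on_powr) fastforce+
    fix x assume "x \<in> {real j<..<real (Suc j)}"
    then have "x > 0" "real n - x > 0" using n[of x] by (auto simp: I_def)
    moreover have "(real n - x) powr (- \<alpha> - 1) = (real n - x) powr (- 1 - \<alpha>)"
      by (subst minus_diff_commute) (rule refl)
    ultimately show "(F has_vector_derivative (b - \<beta> * x powr (\<beta> - 1)) * (real n - x) powr (- \<alpha>) + \<alpha> * e x) (at x)"
      unfolding has_real_derivative_iff_has_vector_derivative[symmetric] F_def e_def b_def
      by (auto intro!: derivative_eq_intros interp_err_has_real_derivative simp: algebra_simps simp del: of_nat_Suc)
  qed simp
  from has_integral_diff[OF this has_integral_mult_right[OF e, of \<alpha>]]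
  have 1: "((\<lambda>x. (b - \<beta> * x powr (\<beta> - 1)) * (real n - x) powr (- \<alpha>)) has_integral - (\<alpha> * integral I e)) I"
    by (simp add: F_def del: of_nat_Suc)
  have "((\<lambda>x. (1 - \<alpha>) * (real n - x) powr (- \<alpha>)) has_integral
      (real n - real j) powr (1 - \<alpha>) - (real n - real (Suc j)) powr (1 - \<alpha>)) I"
    unfolding I_def using assms by (intro has_integral_powr_from_end) auto
  from has_integral_mult_right[OF this, of "b / (1 - \<alpha>)"]
  have 2: "((\<lambda>x. b * (real n - x) powr (- \<alpha>)) has_integral (b * a / (1 - \<alpha>))) I"
    using assms by (simp add: a_def of_nat_diff)
  from has_integral_diff[OF 2 1]
  have "((\<lambda>x. \<beta> * x powr (\<beta> - 1) * (real n - x) powr (- \<alpha>)) has_integral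
      (b * a / (1 - \<alpha>) + \<alpha> * integral I e)) I"
    by (simp add: algebra_simps)
  then have "l1_err \<alpha> \<beta> n j = a * b - (1 - \<alpha>) * (b * a / (1 - \<alpha>) + \<alpha> * integral I e)"
    unfolding l1_err_def a_def b_def I_def by (simp only: integral_unique)
  also have "\<dots> = - (\<alpha> * (1 - \<alpha>) * integral I e)"
    using assms by (simp add: field_simps)
  finally have "integral I e = - l1_err \<alpha> \<beta> n j / (\<alpha> * (1 - \<alpha>))"
    using assms by (simp add: field_simps)
  with e show ?thesis by (simp add: e_def I_def)
qed


text \<open>
  For \<open>c = 0\<close> this bounds the error itself; for \<open>c = n powr (- 1 - \<alpha>)\<close>, the value of the kernel at
  the origin, it isolates the contribution to the zeta term.
\<close>

lemma l1_err_bound: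
  assumes "0 < \<alpha>" "\<alpha> < 1" "\<beta> > 0" "Suc j < n" "0 \<le> c" "c \<le> real n powr (- 1 - \<alpha>)"
  shows "\<bar>l1_err \<alpha> \<beta> n j + \<alpha> * (1 - \<alpha>) * c * trapezoid_err \<beta> j\<bar>
    \<le> \<alpha> * (1 - \<alpha>) * interp_const \<beta> *
        (real (Suc j) powr (\<beta> - 2) * (real (n - Suc j) powr (- 1 - \<alpha>) - c))"
proof -
  define A where "A = \<alpha> * (1 - \<alpha>)"
  have "A > 0" using assms by (simp add: A_def)
  define B where "B = interp_const \<beta> * real (Suc j) powr (\<beta> - 2)"
  have "B \<ge> 0" using assms by (simp add: B_def interp_const_def)
  \<comment> \<open>The kernel increases in \<open>x\<close>, so it stays above its value at 0 and
    hence above \<open>c\<close>; the difference is nonnegative and largest at the right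
    endpoint.\<close>
  have c: "c \<le> (real n - x) powr (- 1 - \<alpha>)" if "x \<in> {real j..real (Suc j)}" for x
  proof -
    have "real n powr (- 1 - \<alpha>) \<le> (real n - x) powr (- 1 - \<alpha>)"
      using that assms by (intro powr_mono2') auto
    with assms show ?thesis by linarith
  qed
  have "((\<lambda>x. interp_err \<beta> j x * (real n - x) powr (- 1 - \<alpha>) - c * interp_err \<beta> j x)
      has_integral (- l1_err \<alpha> \<beta> n j / A - c * trapezoid_err \<beta> j)) (cbox (real j) (real (Suc j)))"
    using has_integral_diff[OF l1_err_eq_integral[OF assms(1-4)]
        has_integral_mult_right[OF interp_err_has_integral[OF assms(3), of j], of c]]
    by (simp add: A_def)
  then have "norm (- l1_err \<alpha> \<beta> n j / A - c * trapezoid_err \<beta> j)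
      \<le> B * (real (n - Suc j) powr (- 1 - \<alpha>) - c) * measure lborel (cbox (real j) (real (Suc j)))"
  proof (rule has_integral_bound[rotated])
    show "0 \<le> B * (real (n - Suc j) powr (- 1 - \<alpha>) - c)"
      using c[of "real (Suc j)"] \<open>B \<ge> 0\<close> assms by (simp add: of_nat_diff)
    fix x assume "x \<in> cbox (real j) (real (Suc j))"
    then have x: "x \<in> {real j..real (Suc j)}" by simp
    have "(real n - x) powr (- 1 - \<alpha>) \<le> real (n - Suc j) powr (- 1 - \<alpha>)"
      using x assms by (intro powr_mono2') (auto simp: of_nat_diff)
    then have "\<bar>(real n - x) powr (- 1 - \<alpha>) - c\<bar> \<le> real (n - Suc j) powr (- 1 - \<alpha>) - c"
      using c[OF x] by linarith
    then have "\<bar>interp_err \<beta> j x\<bar> * \<bar>(real n - x) powr (- 1 - \<alpha>) - c\<bar>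
        \<le> B * (real (n - Suc j) powr (- 1 - \<alpha>) - c)"
      unfolding B_def using interp_err_bound[OF assms(3) x] \<open>B \<ge> 0\<close>[unfolded B_def]
      by (intro mult_mono) auto
    then show "norm (interp_err \<beta> j x * (real n - x) powr (- 1 - \<alpha>) - c * interp_err \<beta> j x)
        \<le> B * (real (n - Suc j) powr (- 1 - \<alpha>) - c)"
      by (simp add: abs_mult[symmetric] algebra_simps)
  qed
  then have "A * \<bar>- l1_err \<alpha> \<beta> n j / A - c * trapezoid_err \<beta> j\<bar>
      \<le> A * (B * (real (n - Suc j) powr (- 1 - \<alpha>) - c))"
    using \<open>A > 0\<close> by (intro mult_left_mono) auto
  moreover have e: "l1_err \<alpha> \<beta> n j + A * c * trapezoid_err \<beta> j
      = - (A * (- l1_err \<alpha> \<beta> n j / A - c * trapezoid_err \<beta> j))"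
    using \<open>A > 0\<close> by (simp add: field_simps)
  have "\<bar>l1_err \<alpha> \<beta> n j + A * c * trapezoid_err \<beta> j\<bar> = A * \<bar>- l1_err \<alpha> \<beta> n j / A - c * trapezoid_err \<beta> j\<bar>"
    unfolding e abs_minus_cancel abs_mult using \<open>A > 0\<close> by simp
  ultimately show ?thesis
    unfolding A_def[symmetric] by (simp only: B_def mult.assoc)
qed

section \<open>The Beta integral and summation by parts\<close>

lemma has_integral_Beta_scaled:
  assumes "0 < \<alpha>" "\<alpha> < 1" "\<beta> > 0" "(c :: real) > 0"
  shows "((\<lambda>x. \<beta> * x powr (\<beta> - 1) * (c - x) powr (- \<alpha>)) has_integral
           (\<beta> * Beta \<beta> (1 - \<alpha>) * c powr (\<beta> - \<alpha>))) {0..c}"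
proof -
  have "((\<lambda>x. x powr (\<beta> - 1) * (1 - x) powr ((1 - \<alpha>) - 1)) has_integral Beta \<beta> (1 - \<alpha>)) (cbox 0 1)"
    using has_integral_Beta_real[of \<beta> "1 - \<alpha>"] assms by simp
  from has_integral_affinity'[OF this, of "1 / c" 0]
  have "((\<lambda>x. (x / c) powr (\<beta> - 1) * (1 - x / c) powr (- \<alpha>)) has_integral (Beta \<beta> (1 - \<alpha>) * c)) {0..c}"
    using assms by (simp add: field_simps)
  from has_integral_mult_right[OF this, of "\<beta> * c powr (\<beta> - \<alpha> - 1)"]
  have "((\<lambda>x. \<beta> * c powr (\<beta> - \<alpha> - 1) * ((x / c) powr (\<beta> - 1) * (1 - x / c) powr (- \<alpha>)))
      has_integral (\<beta> * c powr (\<beta> - \<alpha> - 1) * (Beta \<beta> (1 - \<alpha>) * c))) {0..c}" .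
  moreover have "\<beta> * c powr (\<beta> - \<alpha> - 1) * (Beta \<beta> (1 - \<alpha>) * c) = \<beta> * Beta \<beta> (1 - \<alpha>) * c powr (\<beta> - \<alpha>)"
    using assms powr_add[of c "\<beta> - \<alpha> - 1" 1] by simp
  moreover have "\<beta> * c powr (\<beta> - \<alpha> - 1) * ((x / c) powr (\<beta> - 1) * (1 - x / c) powr (- \<alpha>))
      = \<beta> * x powr (\<beta> - 1) * (c - x) powr (- \<alpha>)" if "x \<in> {0..c}" for x
  proof -
    have "1 - x / c = (c - x) / c" using assms by (simp add: field_simps)
    then have "(x / c) powr (\<beta> - 1) * (1 - x / c) powr (- \<alpha>)
        = x powr (\<beta> - 1) * (c - x) powr (- \<alpha>) / (c powr (\<beta> - 1) * c powr (- \<alpha>))"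
      using that assms by (simp add: powr_divide)
    also have "c powr (\<beta> - 1) * c powr (- \<alpha>) = c powr (\<beta> - \<alpha> - 1)"
      by (simp add: powr_add[symmetric] algebra_simps)
    finally show ?thesis using assms by simp
  qed
  ultimately show ?thesis by (metis (no_types, lifting) has_integral_cong)
qed

lemma integral_split_unit_intervals:
  fixes f :: "real \<Rightarrow> real"
  assumes "f integrable_on {0..real n}"
  shows "integral {0..real n} f = (\<Sum>j<n. integral {real j..real (Suc j)} f)"
  using assms
proof (induction n)
  case (Suc n)
  have "f integrable_on {0..real n}"
    by (rule integrable_on_subinterval[OF Suc.prems]) auto
  moreover have "integral {0..real n} f + integral {real n..real (Suc n)} f = integral {0..real (Suc n)} f"
    using Suc.prems by (intro Henstock_Kurzweil_Integration.integral_combine) auto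
  ultimately show ?case using Suc.IH by simp
qed simp

text \<open>Abel summation after reversing the index. Shifting one of the two resulting sums
  produces the second differences; the term split off in front is \<open>f n\<close> because
  \<open>G 1 - G 0 = 1\<close>, and the one at the far end vanishes because
  \<open>f 0 = 0\<close>.\<close>

lemma sum_second_difference_by_parts:
  fixes G f :: "nat \<Rightarrow> real"
  assumes "G 0 = 0" "G 1 = 1" "f 0 = 0" "n \<ge> 1"
  shows "(\<Sum>k=1..n-1. (G (k + 1) - 2 * G k + G (k - 1)) * f (n - k)) + f n
    = (\<Sum>j<n. (G (n - j) - G (n - Suc j)) * (f (Suc j) - f j))"
proof -
  obtain N where n: "n = Suc N" using \<open>n \<ge> 1\<close> by (cases n) auto
  have "(\<Sum>j<n. (G (n - j) - G (n - Suc j)) * (f (Suc j) - f j))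
      = (\<Sum>k<n. (G (Suc k) - G k) * (f (n - k) - f (n - Suc k)))"
    by (subst sum.nat_diff_reindex[symmetric]) (intro sum.cong, auto simp: Suc_diff_Suc)
  also have "\<dots> = (\<Sum>k<Suc N. (G (Suc k) - G k) * f (n - k)) - (\<Sum>k<Suc N. (G (Suc k) - G k) * f (n - Suc k))"
    by (simp only: n right_diff_distrib sum_subtractf)
  also have "(\<Sum>k<Suc N. (G (Suc k) - G k) * f (n - k))
      = f n + (\<Sum>k<N. (G (Suc (Suc k)) - G (Suc k)) * f (n - Suc k))"
    using assms by (subst sum.lessThan_Suc_shift) simp
  also have "(\<Sum>k<Suc N. (G (Suc k) - G k) * f (n - Suc k)) = (\<Sum>k<N. (G (Suc k) - G k) * f (n - Suc k))"
    using assms by (simp add: n)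
  also have "f n + (\<Sum>k<N. (G (Suc (Suc k)) - G (Suc k)) * f (n - Suc k)) - (\<Sum>k<N. (G (Suc k) - G k) * f (n - Suc k))
      = f n + (\<Sum>k<N. (G (Suc (Suc k)) - G (Suc k)) * f (n - Suc k) - (G (Suc k) - G k) * f (n - Suc k))"
    by (simp only: sum_subtractf add_diff_eq)
  also have "\<dots> = (\<Sum>k<N. (G (Suc k + 1) - 2 * G (Suc k) + G (Suc k - 1)) * f (n - Suc k)) + f n"
    by (simp add: algebra_simps)
  also have "(\<Sum>k<N. (G (Suc k + 1) - 2 * G (Suc k) + G (Suc k - 1)) * f (n - Suc k))
      = (\<Sum>k=1..n-1. (G (k + 1) - 2 * G k + G (k - 1)) * f (n - k))"
    by (simp add: n sum.atLeast1_atMost_eq)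
  finally show ?thesis ..
qed

text \<open>The kernel \<open>(n - x) powr (- 1 - \<alpha>)\<close> is singular on this interval, so
  the slope error is integrated directly against
  \<open>(1 - \<alpha>) * (n - x) powr (- \<alpha>)\<close>, whose total mass there is 1.
  \<open>n \<ge> 2\<close> keeps the interval away from 0.\<close>

lemma l1_last_err_bound:
  assumes "0 < \<alpha>" "\<alpha> < 1" "\<beta> > 0" "n \<ge> 2"
  shows "\<bar>l1_err \<alpha> \<beta> n (n - 1)\<bar> \<le> interp_const \<beta> * real n powr (\<beta> - 2)"
proof -
  obtain j where n: "n = Suc j" and "j \<ge> 1" using \<open>n \<ge> 2\<close> by (cases n) auto
  define b where "b = real (Suc j) powr \<beta> - real j powr \<beta>"
  define B where "B = interp_const \<beta> * real n powr (\<beta> - 2)"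
  define g where "g = (\<lambda>x. \<beta> * x powr (\<beta> - 1) * (real n - x) powr (- \<alpha>))"
  have w: "((\<lambda>x. (1 - \<alpha>) * (real n - x) powr (- \<alpha>)) has_integral 1) {real j..real (Suc j)}"
    using has_integral_powr_from_end[of \<alpha> "real j" "real (Suc j)" "real n"] assms n by simp
  have "g integrable_on {0..real n}"
    unfolding g_def using assms by (intro has_integral_integrable[OF has_integral_Beta_scaled]) auto
  then have "g integrable_on {real j..real (Suc j)}"
    by (rule integrable_on_subinterval) (auto simp: n)
  then have "(g has_integral integral {real j..real (Suc j)} g) {real j..real (Suc j)}"
    by (rule integrable_integral)
  from has_integral_diff[OF has_integral_mult_right[OF w, of b] has_integral_mult_right[OF this, of "1 - \<alpha>"]]
  have 1: "((\<lambda>x. b * ((1 - \<alpha>) * (real n - x) powr (- \<alpha>)) - (1 - \<alpha>) * g x) has_integral l1_err \<alpha> \<beta> n j)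
      {real j..real (Suc j)}"
    by (simp add: l1_err_def n g_def b_def)
  have 2: "((\<lambda>x. B * ((1 - \<alpha>) * (real n - x) powr (- \<alpha>))) has_integral B) {real j..real (Suc j)}"
    using has_integral_mult_right[OF w, of B] by simp
  have "norm (integral {real j..real (Suc j)} (\<lambda>x. b * ((1 - \<alpha>) * (real n - x) powr (- \<alpha>)) - (1 - \<alpha>) * g x))
     \<le> integral {real j..real (Suc j)} (\<lambda>x. B * ((1 - \<alpha>) * (real n - x) powr (- \<alpha>)))"
  proof (rule integral_norm_bound_integral)
    fix x assume x: "x \<in> {real j..real (Suc j)}"
    \<comment> \<open>Subtracting 1 removes the summand of \<open>interp_const\<close> reserved for
      \<open>j = 0\<close>.\<close>
    have "\<bar>b - \<beta> * x powr (\<beta> - 1)\<bar> \<le> (interp_const \<beta> - 1) * real n powr (\<beta> - 2)"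
      using slope_error_bound[OF assms(3) \<open>j \<ge> 1\<close> x] by (simp add: b_def n interp_const_def)
    also have "\<dots> \<le> B" unfolding B_def by (intro mult_right_mono) auto
    finally have "\<bar>b - \<beta> * x powr (\<beta> - 1)\<bar> * ((1 - \<alpha>) * (real n - x) powr (- \<alpha>))
        \<le> B * ((1 - \<alpha>) * (real n - x) powr (- \<alpha>))"
      using assms by (intro mult_right_mono) auto
    moreover have "b * ((1 - \<alpha>) * (real n - x) powr (- \<alpha>)) - (1 - \<alpha>) * g x
        = (b - \<beta> * x powr (\<beta> - 1)) * ((1 - \<alpha>) * (real n - x) powr (- \<alpha>))"
      by (simp add: g_def algebra_simps)
    ultimately show "norm (b * ((1 - \<alpha>) * (real n - x) powr (- \<alpha>)) - (1 - \<alpha>) * g x)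
        \<le> B * ((1 - \<alpha>) * (real n - x) powr (- \<alpha>))"
      using assms by (simp add: abs_mult)
  qed (use 1 2 in blast)+
  then have "\<bar>l1_err \<alpha> \<beta> n j\<bar> \<le> B"
    unfolding integral_unique[OF 1] integral_unique[OF 2] by simp
  then show ?thesis by (simp add: B_def n)
qed

section \<open>The zeta value as the total trapezoidal error\<close>

lemma zeta_eq_dirichlet_zeta:
  assumes "Re s > 1"
  shows "zeta s = dirichlet_zeta s"
proof (rule sums_unique2)
  show "(\<lambda>n. of_nat (Suc n) powr (- s)) sums dirichlet_zeta s"
    by (rule dirichlet_zeta_sums[OF assms])
  show "(\<lambda>n. of_nat (Suc n) powr (- s)) sums zeta s"
    using is_zeta_continuation_zeta assms
    by (simp add: is_zeta_continuation_def powr_minus_divide del: of_nat_Suc)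
qed

lemma zeta_rem_summable:
  assumes "Re s > 1 - real K"
  shows "summable (\<lambda>n. zeta_rem K n s)"
proof (rule summable_norm_cancel, rule summable_comparison_test')
  show "summable (\<lambda>n. norm (\<Prod>j<Suc K. 1 - s - of_nat j) * real (Suc n) powr (- Re s - real K))"
    using assms by (intro summable_mult summable_Suc_powr) auto
  show "norm (norm (zeta_rem K n s))
      \<le> norm (\<Prod>j<Suc K. 1 - s - of_nat j) * real (Suc n) powr (- Re s - real K)" for n
    using zeta_rem_bound[of K s n] assms by simp
qed

text \<open>
  In the combination of remainders on the right-hand side the values \<open>zeta (s + 1)\<close> cancel, and
  each summand is \<open>1 - s\<close> times the trapezoidal error of \<open>x powr (- s)\<close> on \<open>[n + 1, n + 2]\<close>.
\<close>

lemma zeta_eq_zeta_rem_sum: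
  assumes "Re s > -1" "s \<noteq> 1"
  shows "(1 - s) * zeta s = (\<Sum>n. zeta_rem 2 n s) - (1 - s) / 2 * (\<Sum>n. zeta_rem 1 n (s + 1)) - (1 + s) / 2"
proof -
  define H where "H = {s. Re s > -1}"
  define G where "G = (\<lambda>s. (\<Sum>n. zeta_rem 2 n s) - (1 - s) / 2 * (\<Sum>n. zeta_rem 1 n (s + 1)) - (1 + s) / 2)"
  have "(\<lambda>s. (1 - s) * zeta s) s = G s"
  \<comment> \<open>Both series of remainders are holomorphic on \<open>H\<close>: order 2 needs
    \<open>Re s > -1\<close>, and order 1, shifted, needs \<open>Re (s + 1) > 0\<close>. So a
    comparison on \<open>Re s > 1\<close> suffices.\<close>
  proof (rule analytic_continuation_open[of "{s. Re s > 1}" "H - {1}" "\<lambda>s. (1 - s) * zeta s" G])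
    show "{s. Re s > 1} \<noteq> {}" by (auto intro!: exI[of _ 2])
    show "connected (H - {1})"
      unfolding H_def
      by (intro connected_open_delete convex_connected convex_halfspace_Re_gt open_halfspace_Re_gt) simp
    show "open (H - {1})" unfolding H_def by (intro open_Diff open_halfspace_Re_gt) auto
    show "{s. Re s > 1} \<subseteq> H - {1}" by (auto simp: H_def)
    have "zeta holomorphic_on (H - {1})"
      using is_zeta_continuation_zeta unfolding is_zeta_continuation_def
      by (blast intro: holomorphic_on_subset)
    then show "(\<lambda>s. (1 - s) * zeta s) holomorphic_on (H - {1})"
      by (intro holomorphic_intros)
    have "((\<lambda>s. \<Sum>n. zeta_rem 1 n s) \<circ> (\<lambda>s. s + 1)) holomorphic_on (H - {1})"
      using zeta_rem_sum_holomorphic[of 1]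
      by (intro holomorphic_on_compose_gen[where t = "{s. Re s > 1 - real 1}"] holomorphic_intros)
        (auto simp: H_def)
    moreover have "(\<lambda>s. \<Sum>n. zeta_rem 2 n s) holomorphic_on (H - {1})"
      using zeta_rem_sum_holomorphic[of 2] by (rule holomorphic_on_subset) (auto simp: H_def)
    ultimately show "G holomorphic_on (H - {1})"
      unfolding G_def o_def by (intro holomorphic_intros) auto
    show "(1 - z) * zeta z = G z" if "z \<in> {s. Re s > 1}" for z
    proof -
      have z: "Re z > 1" "Re (z + 1) > 1" using that by auto
      have "(\<Sum>n. zeta_rem 2 n z) = 1 + (\<Sum>k=1..2. ((1 - z) gchoose k) * dirichlet_zeta (z + of_nat k - 1))"
        using zeta_rem_sums[OF z(1), of 2] by (simp add: sums_iff)
      moreover have "{1..2::nat} = {1, 2}" by auto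
      ultimately have 2: "(\<Sum>n. zeta_rem 2 n z)
          = 1 + (1 - z) * dirichlet_zeta z + ((1 - z) * (- z) / 2) * dirichlet_zeta (z + 1)"
        by (simp add: gbinomial_prod_rev numeral_2_eq_2 add.commute)
      have 1: "(\<Sum>n. zeta_rem 1 n (z + 1)) = 1 - z * dirichlet_zeta (z + 1)"
        using zeta_rem_sums[OF z(2), of 1] by (simp add: sums_iff add.commute)
      show ?thesis
        unfolding G_def 1 2 zeta_eq_dirichlet_zeta[OF z(1)] by (simp add: field_simps)
    qed
  qed (use assms in \<open>auto simp: H_def open_halfspace_Re_gt\<close>)
  then show ?thesis by (simp add: G_def)
qed

text \<open>Evaluates \<open>zeta_eq_zeta_rem_sum\<close> at \<open>s = - \<beta>\<close>, where
  \<open>\<beta> < 1\<close> places \<open>s\<close> in the half-plane. The remainders start on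
  \<open>[1, 2]\<close>; the constant \<open>(1 + s) / 2\<close> accounts exactly for the missing
  interval \<open>[0, 1]\<close>.\<close>

lemma trapezoid_err_sums_zeta:
  assumes "0 < \<beta>" "\<beta> < 1"
  shows "trapezoid_err \<beta> sums Re (zeta (of_real (- \<beta>)))"
proof -
  define s :: complex where "s = of_real (- \<beta>)"
  have s: "Re s > -1" "s \<noteq> 1" using assms by (auto simp: s_def complex_eq_iff)
  have term_eq: "zeta_rem 2 n s - (1 - s) / 2 * zeta_rem 1 n (s + 1) = of_real ((1 + \<beta>) * trapezoid_err \<beta> (Suc n))"
    for n
  proof -
    define u v where "u = of_nat (Suc n) powr (- s)" and "v = (of_nat (Suc (Suc n)) powr (- s) :: complex)"
    define u1 v1 where "u1 = of_nat (Suc n) powr (1 - s)" and "v1 = (of_nat (Suc (Suc n)) powr (1 - s) :: complex)"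
    have real: "of_nat (Suc m) powr of_real r = (of_real (real (Suc m) powr r) :: complex)" for m r
      by (simp add: powr_of_real[symmetric] del: of_nat_Suc)
    have sums: "(\<Sum>k\<le>2. F k) = F 0 + F 1 + F 2" "(\<Sum>k\<le>1. F k) = F 0 + F 1" for F :: "nat \<Rightarrow> complex"
      by (simp_all add: numeral_2_eq_2)
    have binom: "(a gchoose 2) = a * (a - 1) / 2" "(a gchoose 1) = a" for a :: complex
      by (simp_all add: gbinomial_prod_rev numeral_2_eq_2)
    have expo: "1 - s - of_nat 0 = 1 - s" "1 - s - of_nat 1 = - s" "1 - s - of_nat 2 = - s - 1" "1 - s - 1 = - s"
      "1 - (s + 1) = - s" "- s - of_nat 0 = - s" "- s - of_nat 1 = - s - 1"
      by simp_all
    have rem2: "zeta_rem 2 n s = u1 + (1 - s) * u + (1 - s) * (- s) / 2 * of_nat (Suc n) powr (- s - 1) - v1"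
      unfolding zeta_rem_def sums binom expo u_def u1_def v1_def by simp
    have rem1: "zeta_rem 1 n (s + 1) = u + (- s) * of_nat (Suc n) powr (- s - 1) - v"
      unfolding zeta_rem_def sums expo binom u_def v_def by simp
    have real_eqs: "u = of_real (real (Suc n) powr \<beta>)" "v = of_real (real (Suc (Suc n)) powr \<beta>)"
      "u1 = of_real (real (Suc n) powr (\<beta> + 1))" "v1 = of_real (real (Suc (Suc n)) powr (\<beta> + 1))"
      unfolding u_def v_def u1_def v1_def real[symmetric] by (simp_all add: s_def add.commute)
    have one_minus: "1 - s = of_real (1 + \<beta>)" by (simp add: s_def)
    \<comment> \<open>The terms in \<open>powr (- s - 1)\<close> cancel: the quadratic one of order
      2 against the linear one of order 1.\<close>
    have "zeta_rem 2 n s - (1 - s) / 2 * zeta_rem 1 n (s + 1) = (1 - s) / 2 * (u + v) - (v1 - u1)"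
      unfolding rem1 rem2 by (simp add: field_simps)
    also have "(1 - s) / 2 * (u + v) - (v1 - u1)
        = (of_real ((1 + \<beta>) / 2 * (real (Suc n) powr \<beta> + real (Suc (Suc n)) powr \<beta>)
            - (real (Suc (Suc n)) powr (\<beta> + 1) - real (Suc n) powr (\<beta> + 1))) :: complex)"
      unfolding real_eqs one_minus by simp
    also have "(1 + \<beta>) / 2 * (real (Suc n) powr \<beta> + real (Suc (Suc n)) powr \<beta>)
            - (real (Suc (Suc n)) powr (\<beta> + 1) - real (Suc n) powr (\<beta> + 1)) = (1 + \<beta>) * trapezoid_err \<beta> (Suc n)"
      using assms by (simp add: trapezoid_err_def field_simps del: of_nat_Suc)
    finally show ?thesis .
  qed
  have "(\<lambda>n. zeta_rem 2 n s - (1 - s) / 2 * zeta_rem 1 n (s + 1)) sums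
      ((\<Sum>n. zeta_rem 2 n s) - (1 - s) / 2 * (\<Sum>n. zeta_rem 1 n (s + 1)))"
    using s by (intro sums_diff sums_mult summable_sums zeta_rem_summable) auto
  then have "(\<lambda>n. of_real ((1 + \<beta>) * trapezoid_err \<beta> (Suc n))) sums ((1 - s) * zeta s + (1 + s) / 2)"
    unfolding term_eq zeta_eq_zeta_rem_sum[OF s] by simp
  from sums_Re[OF this]
  have "(\<lambda>n. (1 + \<beta>) * trapezoid_err \<beta> (Suc n)) sums ((1 + \<beta>) * Re (zeta s) + (1 - \<beta>) / 2)"
    by (simp add: s_def)
  from sums_divide[OF this, of "1 + \<beta>"]
  have "(\<lambda>n. trapezoid_err \<beta> (Suc n)) sums (Re (zeta s) + (1 - \<beta>) / 2 / (1 + \<beta>))"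
    using assms by (simp add: add_divide_distrib)
  then have "trapezoid_err \<beta> sums (Re (zeta s) + (1 - \<beta>) / 2 / (1 + \<beta>) + trapezoid_err \<beta> 0)"
    by (rule sums_Suc)
  moreover have "(1 - \<beta>) / 2 / (1 + \<beta>) + trapezoid_err \<beta> 0 = 0"
    using assms by (simp add: trapezoid_err_def field_simps)
  ultimately show ?thesis by (simp add: s_def add.assoc)
qed

section \<open>Bounds for the discrete convolution of the kernels\<close>

text \<open>For \<open>m \<le> n / 2\<close> the factor in \<open>n - m\<close> is of size
  \<open>n powr (- 1 - \<alpha>)\<close>, and \<open>m powr (\<beta> - 2)\<close> splits off
  \<open>m powr (\<beta> - 1 + \<alpha>)\<close>, whose exponent is nonnegative. Otherwise
  \<open>m\<close> is comparable to \<open>n\<close>. What remains is summable in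
  \<open>m\<close>.\<close>

lemma kernel_bound_large_order:
  fixes \<alpha> \<beta> m n :: real
  assumes "0 < \<alpha>" "\<alpha> < 1" "1 - \<alpha> \<le> \<beta>" "0 < m" "m < n"
  shows "m powr (\<beta> - 2) * (n - m) powr (- 1 - \<alpha>)
    \<le> (4 + 2 powr \<bar>\<beta> - 2\<bar>) * n powr (\<beta> - 2) * (m powr (- 1 - \<alpha>) + (n - m) powr (- 1 - \<alpha>))"
proof (cases "2 * m \<le> n")
  case True
  have "(n - m) powr (- 1 - \<alpha>) \<le> 2 powr \<bar>- 1 - \<alpha>\<bar> * n powr (- 1 - \<alpha>)"
    using assms True by (intro powr_le_within_factor_two) auto
  also have "\<dots> \<le> 2 powr 2 * n powr (- 1 - \<alpha>)"
    using assms by (intro mult_right_mono powr_mono) auto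
  finally have 1: "(n - m) powr (- 1 - \<alpha>) \<le> 4 * n powr (- 1 - \<alpha>)" by simp
  have "m powr (\<beta> - 2) = m powr (\<beta> - 1 + \<alpha>) * m powr (- 1 - \<alpha>)"
    by (simp add: powr_add[symmetric])
  also have "\<dots> \<le> n powr (\<beta> - 1 + \<alpha>) * m powr (- 1 - \<alpha>)"
    using assms by (intro mult_right_mono powr_mono2) auto
  finally have "m powr (\<beta> - 2) * (n - m) powr (- 1 - \<alpha>)
      \<le> (n powr (\<beta> - 1 + \<alpha>) * m powr (- 1 - \<alpha>)) * (4 * n powr (- 1 - \<alpha>))"
    by (intro mult_mono 1) auto
  also have "\<dots> = 4 * (n powr (\<beta> - 1 + \<alpha>) * n powr (- 1 - \<alpha>)) * (m powr (- 1 - \<alpha>) + 0)"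
    by (simp add: mult_ac)
  also have "n powr (\<beta> - 1 + \<alpha>) * n powr (- 1 - \<alpha>) = n powr (\<beta> - 2)"
    by (simp add: powr_add[symmetric])
  also have "4 * n powr (\<beta> - 2) * (m powr (- 1 - \<alpha>) + 0)
      \<le> (4 + 2 powr \<bar>\<beta> - 2\<bar>) * n powr (\<beta> - 2) * (m powr (- 1 - \<alpha>) + (n - m) powr (- 1 - \<alpha>))"
    by (intro mult_mono add_mono) auto
  finally show ?thesis .
next
  case False
  have "m powr (\<beta> - 2) * (n - m) powr (- 1 - \<alpha>) \<le> 2 powr \<bar>\<beta> - 2\<bar> * n powr (\<beta> - 2) * (n - m) powr (- 1 - \<alpha>)"
    using assms False by (intro mult_right_mono powr_le_within_factor_two) auto
  also have "\<dots> \<le> (4 + 2 powr \<bar>\<beta> - 2\<bar>) * n powr (\<beta> - 2) * (m powr (- 1 - \<alpha>) + (n - m) powr (- 1 - \<alpha>))"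
    by (intro mult_mono add_mono) auto
  finally show ?thesis .
qed

text \<open>For \<open>m \<le> n / 2\<close>, subtracting the value of the kernel at 0 gains a
  factor of order \<open>m / n\<close> by the mean value theorem. The exponent of the factor split
  off thus rises from \<open>\<beta> - 1 + \<alpha>\<close> to \<open>\<beta> + \<alpha>\<close>,
  which is positive for every \<open>\<beta> > 0\<close>.\<close>

lemma kernel_bound_small_order:
  fixes \<alpha> \<beta> m n :: real
  assumes "0 < \<alpha>" "\<alpha> < 1" "0 < \<beta>" "0 < m" "m < n"
  shows "m powr (\<beta> - 2) * ((n - m) powr (- 1 - \<alpha>) - n powr (- 1 - \<alpha>))
    \<le> (16 + 2 powr \<bar>\<beta> - 2\<bar>) * n powr (\<beta> - 2) * (m powr (- 1 - \<alpha>) + (n - m) powr (- 1 - \<alpha>))"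
proof (cases "2 * m \<le> n")
  case True
  have "\<exists>z. z > n - m \<and> z < n \<and>
      n powr (- 1 - \<alpha>) - (n - m) powr (- 1 - \<alpha>) = (n - (n - m)) * ((- 1 - \<alpha>) * z powr (- 1 - \<alpha> - 1))"
    using assms by (intro MVT2 has_real_derivative_powr) auto
  then obtain z where z: "z > n - m" "z < n"
    and ez: "n powr (- 1 - \<alpha>) - (n - m) powr (- 1 - \<alpha>) = (n - (n - m)) * ((- 1 - \<alpha>) * z powr (- 1 - \<alpha> - 1))"
    by blast
  have "z powr (- 1 - \<alpha> - 1) \<le> 2 powr \<bar>- 1 - \<alpha> - 1\<bar> * n powr (- 1 - \<alpha> - 1)"
    using assms True z by (intro powr_le_within_factor_two) auto
  also have "\<dots> \<le> 2 powr 3 * n powr (- 1 - \<alpha> - 1)"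
    using assms by (intro mult_right_mono powr_mono) auto
  \<comment> \<open>The constant 16 is \<open>2 * 8\<close>: \<open>1 + \<alpha> \<le> 2\<close>,
    and the exponent \<open>2 + \<alpha>\<close> is at most 3.\<close>
  finally have "(1 + \<alpha>) * z powr (- 1 - \<alpha> - 1) \<le> 2 * (8 * n powr (- 1 - \<alpha> - 1))"
    using assms by (intro mult_mono) auto
  then have "m * ((1 + \<alpha>) * z powr (- 1 - \<alpha> - 1)) \<le> m * (2 * (8 * n powr (- 1 - \<alpha> - 1)))"
    using assms by (intro mult_left_mono) auto
  moreover have "(n - m) powr (- 1 - \<alpha>) - n powr (- 1 - \<alpha>) = m * ((1 + \<alpha>) * z powr (- 1 - \<alpha> - 1))"
    using ez by (simp add: algebra_simps)
  ultimately have 1: "(n - m) powr (- 1 - \<alpha>) - n powr (- 1 - \<alpha>) \<le> m * (16 * n powr (- 1 - \<alpha> - 1))"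
    by simp
  have "m powr (\<beta> - 2) * ((n - m) powr (- 1 - \<alpha>) - n powr (- 1 - \<alpha>))
      \<le> m powr (\<beta> - 2) * (m * (16 * n powr (- 1 - \<alpha> - 1)))"
    by (intro mult_left_mono 1) auto
  also have "\<dots> = (m powr (\<beta> - 2) * m powr 1) * (16 * n powr (- 1 - \<alpha> - 1))"
    using assms by simp
  also have "m powr (\<beta> - 2) * m powr 1 = m powr (\<beta> + \<alpha>) * m powr (- 1 - \<alpha>)"
    unfolding powr_add[symmetric] by simp
  also have "m powr (\<beta> + \<alpha>) * m powr (- 1 - \<alpha>) * (16 * n powr (- 1 - \<alpha> - 1))
      \<le> n powr (\<beta> + \<alpha>) * m powr (- 1 - \<alpha>) * (16 * n powr (- 1 - \<alpha> - 1))"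
    using assms by (intro mult_right_mono powr_mono2) auto
  also have "\<dots> = 16 * (n powr (\<beta> + \<alpha>) * n powr (- 1 - \<alpha> - 1)) * (m powr (- 1 - \<alpha>) + 0)"
    by (simp add: mult_ac)
  also have "n powr (\<beta> + \<alpha>) * n powr (- 1 - \<alpha> - 1) = n powr (\<beta> - 2)"
    by (simp add: powr_add[symmetric])
  also have "16 * n powr (\<beta> - 2) * (m powr (- 1 - \<alpha>) + 0)
      \<le> (16 + 2 powr \<bar>\<beta> - 2\<bar>) * n powr (\<beta> - 2) * (m powr (- 1 - \<alpha>) + (n - m) powr (- 1 - \<alpha>))"
    by (intro mult_mono add_mono) auto
  finally show ?thesis .
next
  case False
  have "m powr (\<beta> - 2) * ((n - m) powr (- 1 - \<alpha>) - n powr (- 1 - \<alpha>)) \<le> m powr (\<beta> - 2) * (n - m) powr (- 1 - \<alpha>)"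
    by (intro mult_left_mono) auto
  also have "\<dots> \<le> 2 powr \<bar>\<beta> - 2\<bar> * n powr (\<beta> - 2) * (n - m) powr (- 1 - \<alpha>)"
    using assms False by (intro mult_right_mono powr_le_within_factor_two) auto
  also have "\<dots> \<le> (16 + 2 powr \<bar>\<beta> - 2\<bar>) * n powr (\<beta> - 2) * (m powr (- 1 - \<alpha>) + (n - m) powr (- 1 - \<alpha>))"
    by (intro mult_mono add_mono) auto
  finally show ?thesis .
qed

lemma sum_le_suminf_powr:
  assumes "0 < \<alpha>"
  shows "(\<Sum>k<N. real (Suc k) powr (- 1 - \<alpha>)) \<le> (\<Sum>k. real (Suc k) powr (- 1 - \<alpha>))"
  using assms by (intro sum_le_suminf summable_Suc_powr) auto

text \<open>Reflecting the index turns the second summands into the first, so both are partial sums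
  of one convergent series.\<close>

lemma sum_convolution_kernel_bound:
  assumes "0 < \<alpha>" "n \<ge> 1"
  shows "(\<Sum>j<n-1. real (Suc j) powr (- 1 - \<alpha>) + (real n - real (Suc j)) powr (- 1 - \<alpha>))
    \<le> 2 * (\<Sum>k. real (Suc k) powr (- 1 - \<alpha>))"
proof -
  have "(\<Sum>j<n-1. (real n - real (Suc j)) powr (- 1 - \<alpha>))
      = (\<Sum>j<n-1. real (Suc (n - 1 - Suc j)) powr (- 1 - \<alpha>))"
    by (intro sum.cong refl arg_cong[where f = "\<lambda>x. x powr _"]) (auto simp: of_nat_diff)
  also have "\<dots> = (\<Sum>j<n-1. real (Suc j) powr (- 1 - \<alpha>))"
    by (rule sum.nat_diff_reindex)
  finally show ?thesis
    using sum_le_suminf_powr[OF assms(1), of "n - 1"] by (simp add: sum.distrib del: of_nat_Suc)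
qed

lemma trapezoid_err_bound:
  assumes "\<beta> > 0"
  shows "\<bar>trapezoid_err \<beta> j\<bar> \<le> interp_const \<beta> * real (Suc j) powr (\<beta> - 2)"
proof -
  have "norm (trapezoid_err \<beta> j) \<le> interp_const \<beta> * real (Suc j) powr (\<beta> - 2)
      * measure lborel (cbox (real j) (real (Suc j)))"
    using assms interp_err_bound[OF assms, of _ j] interp_err_has_integral[OF assms, of j]
    by (intro has_integral_bound) (auto simp: interp_const_def simp del: of_nat_Suc)
  then show ?thesis by simp
qed

text \<open>
  The tail is compared with the convergent series of \<open>k powr (- 1 - \<alpha>)\<close>, which costs a factor
  \<open>N powr \<alpha>\<close> against the true order; this is absorbed when the tail is multiplied by
  \<open>n powr (- 1 - \<alpha>)\<close>.
\<close>

lemma trapezoid_err_tail_bound: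
  assumes "0 < \<alpha>" "\<alpha> < 1" "0 < \<beta>" "\<beta> \<le> 1 - \<alpha>"
  shows "\<bar>Re (zeta (of_real (- \<beta>))) - (\<Sum>j<N. trapezoid_err \<beta> j)\<bar>
    \<le> interp_const \<beta> * real (Suc N) powr (\<beta> - 1 + \<alpha>) * (\<Sum>k. real (Suc k) powr (- 1 - \<alpha>))"
proof -
  define c where "c = interp_const \<beta> * real (Suc N) powr (\<beta> - 1 + \<alpha>)"
  have c: "c \<ge> 0" "interp_const \<beta> \<ge> 0" using assms by (simp_all add: c_def interp_const_def)
  have T: "trapezoid_err \<beta> sums Re (zeta (of_real (- \<beta>)))"
    using assms by (intro trapezoid_err_sums_zeta) auto
  have S: "summable (\<lambda>k. real (Suc k) powr (- 1 - \<alpha>))"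
    using assms by (intro summable_Suc_powr) auto
  have S': "summable (\<lambda>k. c * real (Suc (k + N)) powr (- 1 - \<alpha>))"
    using summable_ignore_initial_segment[OF S, of N] by (intro summable_mult)
  have le: "norm (trapezoid_err \<beta> (k + N)) \<le> c * real (Suc (k + N)) powr (- 1 - \<alpha>)" for k
  proof -
    have "norm (trapezoid_err \<beta> (k + N)) \<le> interp_const \<beta> * real (Suc (k + N)) powr (\<beta> - 2)"
      using trapezoid_err_bound[OF assms(3), of "k + N"] by simp
    also have "real (Suc (k + N)) powr (\<beta> - 2)
        = real (Suc (k + N)) powr (\<beta> - 1 + \<alpha>) * real (Suc (k + N)) powr (- 1 - \<alpha>)"
      by (simp add: powr_add[symmetric])
    \<comment> \<open>\<open>\<beta> - 1 + \<alpha> \<le> 0\<close>, so the first factor is largest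
      at \<open>k = 0\<close>.\<close>
    also have "interp_const \<beta> * \<dots> \<le> interp_const \<beta> * (real (Suc N) powr (\<beta> - 1 + \<alpha>) * real (Suc (k + N)) powr (- 1 - \<alpha>))"
      using assms c by (intro mult_left_mono mult_right_mono powr_mono2') auto
    finally show ?thesis by (simp add: c_def mult.assoc)
  qed
  have "Re (zeta (of_real (- \<beta>))) - (\<Sum>j<N. trapezoid_err \<beta> j) = (\<Sum>k. trapezoid_err \<beta> (k + N))"
    using suminf_minus_initial_segment[OF sums_summable[OF T], of N] sums_unique[OF T] by simp
  also have "norm \<dots> \<le> (\<Sum>k. c * real (Suc (k + N)) powr (- 1 - \<alpha>))"
    by (rule norm_suminf_le[OF le S'])
  also have "\<dots> = c * (\<Sum>k. real (Suc (k + N)) powr (- 1 - \<alpha>))"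
    using summable_ignore_initial_segment[OF S, of N] by (rule suminf_mult)
  also have "\<dots> \<le> c * (\<Sum>k. real (Suc k) powr (- 1 - \<alpha>))"
    using suminf_minus_initial_segment[OF S, of N] c
      sum_nonneg[of "{..<N}" "\<lambda>k. real (Suc k) powr (- 1 - \<alpha>)"]
    by (intro mult_left_mono) (auto simp del: of_nat_Suc)
  finally show ?thesis by (simp add: c_def)
qed

section \<open>Summation of the interval errors and scaling back\<close>

text \<open>This is the expansion at unit step size. The last interval is split off because the
  kernel bounds require \<open>Suc j < n\<close>.\<close>

lemma l1_err_sum_bound:
  assumes "0 < \<alpha>" "\<alpha> < 1" "0 < \<beta>"
  shows "\<exists>C. \<forall>n\<ge>2. \<bar>(\<Sum>j<n. l1_err \<alpha> \<beta> n j) + \<alpha> * (1 - \<alpha>) * Re (zeta (of_real (- \<beta>))) * real n powr (- 1 - \<alpha>)\<bar>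
    \<le> C * real n powr (\<beta> - 2)"
proof -
  define A Z Y where "A = \<alpha> * (1 - \<alpha>)" and "Z = (\<Sum>k. real (Suc k) powr (- 1 - \<alpha>))"
    and "Y = Re (zeta (of_real (- \<beta>)))"
  \<comment> \<open>16 also dominates the 4 of \<open>kernel_bound_large_order\<close>, so one
    constant serves both cases.\<close>
  define K where "K = 16 + 2 powr \<bar>\<beta> - 2\<bar>"
  define g where "g = (\<lambda>n j. real (Suc j) powr (- 1 - \<alpha>) + (real n - real (Suc j)) powr (- 1 - \<alpha>))"
  have pos: "A \<ge> 0" "interp_const \<beta> \<ge> 0" "K \<ge> 0"
    using assms by (simp_all add: A_def K_def interp_const_def)
  have split: "(\<Sum>j<n. f j) = (\<Sum>j<n-1. f j) + f (n - 1)" if "n \<ge> 2" for n and f :: "nat \<Rightarrow> real"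
    using that by (cases n) auto
  have sum_bound: "\<bar>\<Sum>j<n-1. f j\<bar> \<le> A * interp_const \<beta> * (K * (2 * Z)) * real n powr (\<beta> - 2)"
    if "n \<ge> 2"
      and f: "\<And>j. Suc j < n \<Longrightarrow> \<bar>f j\<bar> \<le> A * interp_const \<beta> * (K * real n powr (\<beta> - 2) * g n j)" for n f
  proof -
    have "\<bar>\<Sum>j<n-1. f j\<bar> \<le> (\<Sum>j<n-1. A * interp_const \<beta> * (K * real n powr (\<beta> - 2) * g n j))"
      by (intro order.trans[OF sum_abs] sum_mono f) auto
    also have "\<dots> = A * interp_const \<beta> * (K * real n powr (\<beta> - 2) * (\<Sum>j<n-1. g n j))"
      by (simp only: sum_distrib_left)
    also have "\<dots> \<le> A * interp_const \<beta> * (K * real n powr (\<beta> - 2) * (2 * Z))"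
      using pos sum_convolution_kernel_bound[OF assms(1), of n] \<open>n \<ge> 2\<close>
      by (intro mult_left_mono) (auto simp: g_def Z_def)
    finally show ?thesis by (simp add: mult_ac)
  qed
  \<comment> \<open>For \<open>1 - \<alpha> \<le> \<beta>\<close> the zeta term is itself \<open>O(n powr (\<beta> - 2))\<close>, so it need not be identified.\<close>
  show ?thesis
  proof (cases "1 - \<alpha> \<le> \<beta>")
    case True
    have "\<bar>(\<Sum>j<n. l1_err \<alpha> \<beta> n j) + A * Y * real n powr (- 1 - \<alpha>)\<bar>
        \<le> (A * interp_const \<beta> * (K * (2 * Z)) + interp_const \<beta> + A * \<bar>Y\<bar>) * real n powr (\<beta> - 2)"
      if n: "n \<ge> 2" for n
    proof -
      have "\<bar>\<Sum>j<n-1. l1_err \<alpha> \<beta> n j\<bar> \<le> A * interp_const \<beta> * (K * (2 * Z)) * real n powr (\<beta> - 2)"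
      proof (rule sum_bound[OF n])
        fix j assume j: "Suc j < n"
        have "real (Suc j) powr (\<beta> - 2) * (real n - real (Suc j)) powr (- 1 - \<alpha>)
            \<le> (4 + 2 powr \<bar>\<beta> - 2\<bar>) * real n powr (\<beta> - 2) * g n j"
          unfolding g_def using assms True j by (intro kernel_bound_large_order) auto
        also have "\<dots> \<le> K * real n powr (\<beta> - 2) * g n j"
          by (intro mult_right_mono) (auto simp: K_def g_def)
        finally have "A * interp_const \<beta> * (real (Suc j) powr (\<beta> - 2) * (real n - real (Suc j)) powr (- 1 - \<alpha>))
            \<le> A * interp_const \<beta> * (K * real n powr (\<beta> - 2) * g n j)"
          using pos by (intro mult_left_mono) auto
        moreover have "\<bar>l1_err \<alpha> \<beta> n j\<bar>
            \<le> A * interp_const \<beta> * (real (Suc j) powr (\<beta> - 2) * (real n - real (Suc j)) powr (- 1 - \<alpha>))"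
          using l1_err_bound[OF assms j, of 0] j by (simp add: A_def of_nat_diff del: of_nat_Suc)
        ultimately show "\<bar>l1_err \<alpha> \<beta> n j\<bar> \<le> A * interp_const \<beta> * (K * real n powr (\<beta> - 2) * g n j)"
          by linarith
      qed
      moreover have "\<bar>l1_err \<alpha> \<beta> n (n - 1)\<bar> \<le> interp_const \<beta> * real n powr (\<beta> - 2)"
        using assms n by (rule l1_last_err_bound)
      moreover have "\<bar>A * Y * real n powr (- 1 - \<alpha>)\<bar> \<le> A * \<bar>Y\<bar> * real n powr (\<beta> - 2)"
        using assms True n pos by (auto simp: abs_mult intro!: mult_left_mono powr_mono)
      ultimately show ?thesis unfolding split[OF n] distrib_right by linarith
    qed
    then show ?thesis unfolding A_def Y_def by blast
  next
    case False
    have "\<bar>(\<Sum>j<n. l1_err \<alpha> \<beta> n j) + A * Y * real n powr (- 1 - \<alpha>)\<bar>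
        \<le> (A * interp_const \<beta> * (K * (2 * Z)) + interp_const \<beta> + A * interp_const \<beta> * Z) * real n powr (\<beta> - 2)"
      if n: "n \<ge> 2" for n
    proof -
      define w where "w = real n powr (- 1 - \<alpha>)"
      define T where "T = (\<Sum>j<n-1. trapezoid_err \<beta> j)"
      have "\<bar>\<Sum>j<n-1. l1_err \<alpha> \<beta> n j + A * w * trapezoid_err \<beta> j\<bar>
          \<le> A * interp_const \<beta> * (K * (2 * Z)) * real n powr (\<beta> - 2)"
      proof (rule sum_bound[OF n])
        fix j assume j: "Suc j < n"
        have "real (Suc j) powr (\<beta> - 2) * ((real n - real (Suc j)) powr (- 1 - \<alpha>) - w)
            \<le> K * real n powr (\<beta> - 2) * g n j"
          unfolding g_def K_def w_def using assms j by (intro kernel_bound_small_order) auto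
        then have "A * interp_const \<beta> * (real (Suc j) powr (\<beta> - 2) * ((real n - real (Suc j)) powr (- 1 - \<alpha>) - w))
            \<le> A * interp_const \<beta> * (K * real n powr (\<beta> - 2) * g n j)"
          using pos by (intro mult_left_mono) auto
        moreover have "\<bar>l1_err \<alpha> \<beta> n j + A * w * trapezoid_err \<beta> j\<bar>
            \<le> A * interp_const \<beta> * (real (Suc j) powr (\<beta> - 2) * ((real n - real (Suc j)) powr (- 1 - \<alpha>) - w))"
          using l1_err_bound[OF assms j, of w] j by (simp add: A_def w_def of_nat_diff del: of_nat_Suc)
        ultimately show "\<bar>l1_err \<alpha> \<beta> n j + A * w * trapezoid_err \<beta> j\<bar>
            \<le> A * interp_const \<beta> * (K * real n powr (\<beta> - 2) * g n j)"
          by linarith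
      qed
      moreover have "(\<Sum>j<n-1. l1_err \<alpha> \<beta> n j + A * w * trapezoid_err \<beta> j) = (\<Sum>j<n-1. l1_err \<alpha> \<beta> n j) + A * w * T"
        by (simp add: sum.distrib sum_distrib_left T_def)
      moreover have "\<bar>l1_err \<alpha> \<beta> n (n - 1)\<bar> \<le> interp_const \<beta> * real n powr (\<beta> - 2)"
        using assms n by (rule l1_last_err_bound)
      moreover have "\<bar>A * w * (Y - T)\<bar> \<le> A * interp_const \<beta> * Z * real n powr (\<beta> - 2)"
      proof -
        \<comment> \<open>The tail starts at \<open>N = n - 1\<close>, so \<open>Suc N\<close> is
          \<open>n\<close>; multiplication by \<open>w\<close> turns the exponent
          \<open>\<beta> - 1 + \<alpha>\<close> into \<open>\<beta> - 2\<close>.\<close>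
        have "\<bar>Y - T\<bar> \<le> interp_const \<beta> * real n powr (\<beta> - 1 + \<alpha>) * Z"
          using trapezoid_err_tail_bound[of \<alpha> \<beta> "n - 1"] assms False n by (simp add: Y_def T_def Z_def)
        then have "A * w * \<bar>Y - T\<bar> \<le> A * w * (interp_const \<beta> * real n powr (\<beta> - 1 + \<alpha>) * Z)"
          using pos by (intro mult_left_mono) (auto simp: w_def)
        also have "\<dots> = A * interp_const \<beta> * Z * (real n powr (\<beta> - 1 + \<alpha>) * real n powr (- 1 - \<alpha>))"
          by (simp add: w_def mult_ac)
        also have "real n powr (\<beta> - 1 + \<alpha>) * real n powr (- 1 - \<alpha>) = real n powr (\<beta> - 2)"
          by (simp add: powr_add[symmetric])
        finally show ?thesis using pos by (simp add: abs_mult w_def)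
      qed
      moreover have "A * w * (Y - T) = A * Y * w - A * w * T" by (simp add: algebra_simps)
      ultimately show ?thesis
        unfolding split[OF n] w_def[symmetric] distrib_right by linarith
    qed
    then show ?thesis unfolding A_def Y_def by blast
  qed
qed

theorem claim6:
  fixes \<alpha> \<beta> t :: real and y :: "real \<Rightarrow> real" and h :: "nat \<Rightarrow> real"
  assumes "0 < \<alpha>" and "\<alpha> < 1" and "\<beta> > 0" and "t > 0"
    and y: "y = (\<lambda>x. x powr \<beta>)"
    and h: "h = (\<lambda>n. t / real n)"
  shows "(\<lambda>n. 1 / (Gamma (2 - \<alpha>) * h n powr \<alpha>) *
              ((\<Sum>k=1..n-1. (real (k + 1) powr (1 - \<alpha>) - 2 * real k powr (1 - \<alpha>)
                              + real (k - 1) powr (1 - \<alpha>)) * y (real (n - k) * h n))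
               + y (real n * h n))
            - (caputo_deriv \<alpha> y t
               + Re (zeta (of_real (- \<beta>))) / (Gamma (- \<alpha>) * t powr (1 + \<alpha>))
                   * h n powr (1 + \<beta>)))
         \<in> O[at_top](\<lambda>n. h n powr (2 - \<alpha>))"
proof -
  define B where "B = \<beta> * Beta \<beta> (1 - \<alpha>)"
  define Y where "Y = Re (zeta (of_real (- \<beta>)))"
  define \<Gamma> where "\<Gamma> = Gamma (2 - \<alpha>)"
  have "\<Gamma> > 0" using assms by (simp add: \<Gamma>_def)
  have G1: "1 / Gamma (1 - \<alpha>) = (1 - \<alpha>) / \<Gamma>"
  proof -
    have "1 - \<alpha> \<notin> \<int>\<^sub>\<le>\<^sub>0" using assms by (auto elim!: nonpos_Ints_cases')
    then have "\<Gamma> = (1 - \<alpha>) * Gamma (1 - \<alpha>)"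
      using Gamma_plus1[of "1 - \<alpha>"] by (simp add: \<Gamma>_def)
    then show ?thesis using assms by simp
  qed
  \<comment> \<open>This converts the coefficient \<open>\<alpha> * (1 - \<alpha>)\<close> of the
    zeta term; the negative sign of \<open>Gamma (- \<alpha>)\<close> matches the plus sign in
    \<open>l1_err_sum_bound\<close>.\<close>
  have G2: "1 / Gamma (- \<alpha>) = - (\<alpha> * (1 - \<alpha>)) / \<Gamma>"
  proof -
    have "- \<alpha> \<notin> \<int>\<^sub>\<le>\<^sub>0"
    proof
      assume "- \<alpha> \<in> \<int>\<^sub>\<le>\<^sub>0"
      then obtain n where "- \<alpha> = - real n" by (elim nonpos_Ints_cases')
      then have "real 0 < real n" "real n < real 1" using assms by simp_all
      then show False unfolding of_nat_less_iff by simp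
    qed
    then have "Gamma (1 - \<alpha>) = - \<alpha> * Gamma (- \<alpha>)"
      using Gamma_plus1[of "- \<alpha>"] by (simp add: algebra_simps)
    then have "1 / Gamma (- \<alpha>) = - \<alpha> * (1 / Gamma (1 - \<alpha>))"
      using assms by simp
    then show ?thesis unfolding G1 by simp
  qed
  have caputo: "caputo_deriv \<alpha> y t = (1 - \<alpha>) / \<Gamma> * (B * t powr (\<beta> - \<alpha>))"
  proof -
    have "((\<lambda>x. deriv y x / (t - x) powr \<alpha>) has_integral (B * t powr (\<beta> - \<alpha>))) {0..t}"
      unfolding B_def
    \<comment> \<open>At 0 the value of \<open>deriv y\<close> need not follow the power rule, so
      this single point is discarded. At \<open>x = t\<close> both integrands are 0, by the
      conventions for division by zero and \<open>0 powr _\<close>.\<close>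
    proof (rule has_integral_spike_finite[of "{0}"])
      show "((\<lambda>x. \<beta> * x powr (\<beta> - 1) * (t - x) powr (- \<alpha>)) has_integral
          \<beta> * Beta \<beta> (1 - \<alpha>) * t powr (\<beta> - \<alpha>)) {0..t}"
        using assms by (intro has_integral_Beta_scaled)
      fix x assume "x \<in> {0..t} - {0}"
      then have "deriv y x = \<beta> * x powr (\<beta> - 1)"
        unfolding y by (intro DERIV_imp_deriv has_real_derivative_powr) auto
      then show "deriv y x / (t - x) powr \<alpha> = \<beta> * x powr (\<beta> - 1) * (t - x) powr (- \<alpha>)"
        by (simp add: powr_minus_divide)
    qed simp
    then show ?thesis
      unfolding caputo_deriv_def by (simp add: integral_unique G1[symmetric])
  qed
  obtain C where C: "\<And>n. n \<ge> 2 \<Longrightarrow> \<bar>(\<Sum>j<n. l1_err \<alpha> \<beta> n j) + \<alpha> * (1 - \<alpha>) * Y * real n powr (- 1 - \<alpha>)\<bar>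
      \<le> C * real n powr (\<beta> - 2)"
    using l1_err_sum_bound[OF assms(1-3)] unfolding Y_def by blast
  have bound: "norm (1 / (Gamma (2 - \<alpha>) * h n powr \<alpha>) *
              ((\<Sum>k=1..n-1. (real (k + 1) powr (1 - \<alpha>) - 2 * real k powr (1 - \<alpha>)
                              + real (k - 1) powr (1 - \<alpha>)) * y (real (n - k) * h n))
               + y (real n * h n))
            - (caputo_deriv \<alpha> y t
               + Re (zeta (of_real (- \<beta>))) / (Gamma (- \<alpha>) * t powr (1 + \<alpha>))
                   * h n powr (1 + \<beta>)))
      \<le> C * t powr (\<beta> - 2) / \<Gamma> * norm (h n powr (2 - \<alpha>))" if n: "n \<ge> 2" for n
  proof -
    \<comment> \<open>Since \<open>t = N * H\<close>, every term is
      \<open>H powr (\<beta> - \<alpha>)\<close> times its unit-step counterpart in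
      \<open>N\<close>, to which \<open>l1_err_sum_bound\<close> applies.\<close>
    define H N where "H = h n" and "N = real n"
    have pos: "H > 0" "N > 0" and t: "t = N * H" using assms n by (simp_all add: H_def N_def h)
    define S where "S = (\<Sum>k=1..n-1. (real (k + 1) powr (1 - \<alpha>) - 2 * real k powr (1 - \<alpha>)
        + real (k - 1) powr (1 - \<alpha>)) * real (n - k) powr \<beta>) + real n powr \<beta>"
    have I: "((\<lambda>x. \<beta> * x powr (\<beta> - 1) * (real n - x) powr (- \<alpha>)) has_integral B * N powr (\<beta> - \<alpha>)) {0..real n}"
      unfolding B_def N_def using assms n by (intro has_integral_Beta_scaled) auto
    have "(\<Sum>j<n. l1_err \<alpha> \<beta> n j) = S - (1 - \<alpha>) * (B * N powr (\<beta> - \<alpha>))"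
    proof -
      have "S = (\<Sum>j<n. (real (n - j) powr (1 - \<alpha>) - real (n - Suc j) powr (1 - \<alpha>)) *
          (real (Suc j) powr \<beta> - real j powr \<beta>))"
        unfolding S_def
        using n by (intro sum_second_difference_by_parts[of "\<lambda>k. real k powr (1 - \<alpha>)" "\<lambda>k. real k powr \<beta>"]) auto
      \<comment> \<open>The integrals inside \<open>l1_err\<close> join up to the Beta integral over
        \<open>[0, n]\<close>.\<close>
      then show ?thesis
        unfolding l1_err_def sum_subtractf sum_distrib_left[symmetric]
          integral_split_unit_intervals[OF has_integral_integrable[OF I], symmetric] integral_unique[OF I]
        by simp
    qed
    then have main: "\<bar>S - (1 - \<alpha>) * (B * N powr (\<beta> - \<alpha>)) + \<alpha> * (1 - \<alpha>) * Y * N powr (- 1 - \<alpha>)\<bar> \<le> C * N powr (\<beta> - 2)"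
      using C[OF n] by (simp add: N_def)
    have S: "(\<Sum>k=1..n-1. (real (k + 1) powr (1 - \<alpha>) - 2 * real k powr (1 - \<alpha>)
        + real (k - 1) powr (1 - \<alpha>)) * y (real (n - k) * H)) + y (real n * H) = H powr \<beta> * S"
      using pos by (simp add: S_def y powr_mult sum_distrib_left distrib_left mult_ac)
    have e1: "1 / (\<Gamma> * H powr \<alpha>) * (H powr \<beta> * S) = H powr (\<beta> - \<alpha>) / \<Gamma> * S"
      using pos by (simp add: powr_diff)
    have e2: "t powr (\<beta> - \<alpha>) = H powr (\<beta> - \<alpha>) * N powr (\<beta> - \<alpha>)"
      using pos by (simp add: t powr_mult)
    have "H powr (1 + \<beta>) / t powr (1 + \<alpha>) = H powr (\<beta> - \<alpha>) * N powr (- 1 - \<alpha>)"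
    proof -
      have "H powr (1 + \<beta>) = H powr (\<beta> - \<alpha>) * H powr (1 + \<alpha>)"
        unfolding powr_add[symmetric] by (simp add: add.commute)
      moreover have "N powr (- 1 - \<alpha>) = 1 / N powr (1 + \<alpha>)"
        using powr_minus_divide[of N "1 + \<alpha>"] by simp
      ultimately show ?thesis using pos by (simp add: t powr_mult)
    qed
    then have e3: "Y / (Gamma (- \<alpha>) * t powr (1 + \<alpha>)) * H powr (1 + \<beta>)
        = Y * (- (\<alpha> * (1 - \<alpha>)) / \<Gamma>) * (H powr (\<beta> - \<alpha>) * N powr (- 1 - \<alpha>))"
      unfolding G2[symmetric] by (metis (no_types, opaque_lifting) divide_divide_eq_left times_divide_eq_left
          times_divide_eq_right mult.right_neutral)
    \<comment> \<open>This trades the unit-step order \<open>N powr (\<beta> - 2)\<close> for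
      \<open>H powr (2 - \<alpha>)\<close>, at the price of a factor that is constant because
      \<open>t\<close> is fixed.\<close>
    have e4: "t powr (\<beta> - 2) * H powr (2 - \<alpha>) = H powr (\<beta> - \<alpha>) * N powr (\<beta> - 2)"
    proof -
      have "H powr (\<beta> - 2) * H powr (2 - \<alpha>) = H powr (\<beta> - \<alpha>)"
        unfolding powr_add[symmetric] by simp
      then show ?thesis using pos by (simp add: t powr_mult mult_ac)
    qed
    have "1 / (\<Gamma> * H powr \<alpha>) * (H powr \<beta> * S) - ((1 - \<alpha>) / \<Gamma> * (B * t powr (\<beta> - \<alpha>))
          + Y / (Gamma (- \<alpha>) * t powr (1 + \<alpha>)) * H powr (1 + \<beta>))
        = H powr (\<beta> - \<alpha>) / \<Gamma> * (S - (1 - \<alpha>) * (B * N powr (\<beta> - \<alpha>)) + \<alpha> * (1 - \<alpha>) * Y * N powr (- 1 - \<alpha>))"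
      unfolding e1 e2 e3 using \<open>\<Gamma> > 0\<close> by (simp add: field_simps)
    also have "norm \<dots> \<le> H powr (\<beta> - \<alpha>) / \<Gamma> * (C * N powr (\<beta> - 2))"
      unfolding norm_mult using main \<open>\<Gamma> > 0\<close> by (intro mult_mono) auto
    also have "\<dots> = C / \<Gamma> * (t powr (\<beta> - 2) * H powr (2 - \<alpha>))"
      unfolding e4 by simp
    finally show ?thesis
      unfolding H_def[symmetric] S \<Gamma>_def[symmetric] caputo Y_def[symmetric] by simp
  qed
  show ?thesis
    by (rule bigoI[of _ "C * t powr (\<beta> - 2) / \<Gamma>"]) (use bound in \<open>auto simp: eventually_at_top_linorder\<close>)
qed

end
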